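(* There exists a universal constant $c_1 \ge 1$ such that for every $m$-homogeneous polynomial $P : \mathbb{C}^n \to \mathbb{C}$ and every $1$-unconditional norm $\|\cdot\|$ on $\mathbb{C}^n$, $$\sup_{\|x^{(k)}\| \le 1} \bigl| L_P\bigl(x^{(1)}, \dots, x^{(m)}\bigr) \bigr| \;\le\; (c_1 \log n)^{m^2} \cdot \sup_{\|x\| \le 1} |P(x)| .$$ Moreover, if $\|\cdot\| = \|\cdot\|_p$ for $1 \le p < 2$, then there even is a constant $c_2 = c_2(p) \ge 1$ (depending only on $p$) for which, for every $m$-homogeneous polynomial $P : \mathbb{C}^n \to \mathbb{C}$, $$\sup_{\|x^{(k)}\|_p \le 1} \bigl| L_P\bigl(x^{(1)}, \dots, x^{(m)}\bigr) \bigr| \;\le\; c_2^{m^2} \cdot \sup_{\|x\|_p \le 1} |P(x)| .$$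
   Context: Every $m$-homogeneous polynomial $P : \mathbb{C}^n \to \mathbb{C}$ has a unique representation $$P(x) = \sum_{1 \le j_1 \le \dots \le j_m \le n} c_{(j_1,\dots,j_m)}\, x_{j_1} \cdots x_{j_m}.$$ The (in general non-symmetric) $m$-linear form $L_P : (\mathbb{C}^n)^m \to \mathbb{C}$ associated to $P$ is $$L_P\bigl(x^{(1)}, \dots, x^{(m)}\bigr) := \sum_{1 \le j_1 \le \dots \le j_m \le n} c_{(j_1,\dots,j_m)}\, x^{(1)}_{j_1} \cdots x^{(m)}_{j_m}.$$ A norm $\|\cdot\|$ on $\mathbb{C}^n$ is $1$-unconditional if for $x,y\in\mathbb{C}^n$, $|x_k| \le |y_k|$ for every $k$ implies $\|x\| \le \|y\|$. $\|\cdot\|_p$ denotes the $\ell_p$-norm on $\mathbb{C}^n$. The suprema on the left-hand sides are taken over all $x^{(1)},\dots,x^{(m)} \in \mathbb{C}^n$ such that each $x^{(k)}$, $1 \le k \le m$, has norm at most $1$; those on the right-hand sides are over all $x \in \mathbb{C}^n$ of norm at most $1$.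
   Formalization: The first inequality (for 1-unconditional norms) is stated for n ≥ 2 only, since for n = 1 we have log n = 0 and it fails, e.g. for m = 1 and P(x) = x. *)

theory Defs
  imports "Jordan_Normal_Form.Matrix" "HOL-Computational_Algebra.Polynomial"
begin

text \<open>
  The dimension \<open>n\<close> is quantified inside the theorem, so \<open>\<complex>\<^sup>n\<close> is
  \<^term>\<open>carrier_vec n :: complex vec set\<close>. Coordinates and arguments are numbered from 0.
\<close>

definition is_norm :: "nat \<Rightarrow> (complex vec \<Rightarrow> real) \<Rightarrow> bool" where
  "is_norm n N \<longleftrightarrow>
     (\<forall>x\<in>carrier_vec n. 0 \<le> N x) \<and>
     (\<forall>x\<in>carrier_vec n. N x = 0 \<longleftrightarrow> x = 0\<^sub>v n) \<and>
     (\<forall>a. \<forall>x\<in>carrier_vec n. N (a \<cdot>\<^sub>v x) = cmod a * N x) \<and>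
     (\<forall>x\<in>carrier_vec n. \<forall>y\<in>carrier_vec n. N (x + y) \<le> N x + N y)"

definition one_unconditional :: "nat \<Rightarrow> (complex vec \<Rightarrow> real) \<Rightarrow> bool" where
  "one_unconditional n N \<longleftrightarrow>
     (\<forall>x\<in>carrier_vec n. \<forall>y\<in>carrier_vec n.
        (\<forall>k<n. cmod (x $ k) \<le> cmod (y $ k)) \<longrightarrow> N x \<le> N y)"

definition lp_norm :: "real \<Rightarrow> complex vec \<Rightarrow> real" where
  "lp_norm p x = (\<Sum>k<dim_vec x. cmod (x $ k) powr p) powr (1 / p)"

definition monotone_indices :: "nat \<Rightarrow> nat \<Rightarrow> nat list set" where
  "monotone_indices n m = {j. length j = m \<and> sorted j \<and> set j \<subseteq> {..<n}}"

text \<open>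
  \<open>c\<close> is required to vanish off the index set, so that it is determined by the function \<open>P\<close>
  as a total function on lists; only the values of \<open>P\<close> on \<^term>\<open>carrier_vec n\<close> matter.
\<close>

definition represents :: "nat \<Rightarrow> nat \<Rightarrow> (nat list \<Rightarrow> complex) \<Rightarrow> (complex vec \<Rightarrow> complex) \<Rightarrow> bool" where
  "represents n m c P \<longleftrightarrow>
     (\<forall>j. j \<notin> monotone_indices n m \<longrightarrow> c j = 0) \<and>
     (\<forall>x\<in>carrier_vec n. P x = (\<Sum>j\<in>monotone_indices n m. c j * (\<Prod>k<m. x $ (j ! k))))"

definition homogeneous_polynomial :: "nat \<Rightarrow> nat \<Rightarrow> (complex vec \<Rightarrow> complex) \<Rightarrow> bool" where
  "homogeneous_polynomial n m P \<longleftrightarrow> (\<exists>c. represents n m c P)"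

definition coefficients :: "nat \<Rightarrow> nat \<Rightarrow> (complex vec \<Rightarrow> complex) \<Rightarrow> nat list \<Rightarrow> complex" where
  "coefficients n m P = (THE c. represents n m c P)"

text \<open>The \<open>m\<close> arguments of the form are \<open>X 0, \<dots>, X (m - 1)\<close>; other values of \<open>X\<close> are irrelevant.\<close>

definition associated_form ::
    "nat \<Rightarrow> nat \<Rightarrow> (complex vec \<Rightarrow> complex) \<Rightarrow> (nat \<Rightarrow> complex vec) \<Rightarrow> complex" where
  "associated_form n m P X =
     (\<Sum>j\<in>monotone_indices n m. coefficients n m P j * (\<Prod>k<m. X k $ (j ! k)))"

text \<open>
  The coefficients are well defined: substituting \<open>x\<^sub>i = t ^ ((m + 1) ^ i)\<close> sends
  distinct monomials of degree \<open>m\<close> to distinct powers of \<open>t\<close>.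
\<close>

lemma digits_unique:
  fixes a b :: "nat \<Rightarrow> nat"
  assumes "\<And>i. a i < B" "\<And>i. b i < B"
    and "(\<Sum>i<n. a i * B ^ i) = (\<Sum>i<n. b i * B ^ i)" "i < n"
  shows "a i = b i"
  using assms
proof (induction n arbitrary: a b i)
  case 0
  then show ?case by simp
next
  case (Suc n)
  have B: "B > 0" using Suc.prems(1)[of 0] by simp
  have shift: "(\<Sum>i<Suc n. f i * B ^ i) = f 0 + B * (\<Sum>i<n. f (Suc i) * B ^ i)" for f :: "nat \<Rightarrow> nat"
    by (simp add: sum.lessThan_Suc_shift sum_distrib_left mult_ac del: sum.lessThan_Suc)
  have eq: "a 0 + B * (\<Sum>i<n. a (Suc i) * B ^ i) = b 0 + B * (\<Sum>i<n. b (Suc i) * B ^ i)"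
    using Suc.prems(3) shift by metis
  have 0: "a 0 = b 0"
    using arg_cong[OF eq, of "\<lambda>u. u mod B"] Suc.prems(1,2) by simp
  have 1: "(\<Sum>i<n. a (Suc i) * B ^ i) = (\<Sum>i<n. b (Suc i) * B ^ i)"
    using eq 0 B by simp
  show ?case
  proof (cases i)
    case 0
    then show ?thesis using \<open>a 0 = b 0\<close> by simp
  next
    case (Suc i')
    then show ?thesis
      using Suc.IH[of "\<lambda>i. a (Suc i)" "\<lambda>i. b (Suc i)" i'] Suc.prems 1 by simp
  qed
qed

lemma finite_monotone_indices: "finite (monotone_indices n m)"
  by (rule finite_subset[OF _ finite_lists_length_eq[of "{..<n}" m]])
     (auto simp: monotone_indices_def)

lemma inj_on_kronecker:
  "inj_on (\<lambda>j. \<Sum>k<m. Suc m ^ (j ! k)) (monotone_indices n m)"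
proof (rule inj_onI)
  fix j j'
  assume j: "j \<in> monotone_indices n m" and j': "j' \<in> monotone_indices n m"
    and eq: "(\<Sum>k<m. Suc m ^ (j ! k)) = (\<Sum>k<m. Suc m ^ (j' ! k))"
  have count: "(\<Sum>k<m. Suc m ^ (l ! k)) = (\<Sum>i<n. count_list l i * Suc m ^ i)"
    if "l \<in> monotone_indices n m" for l
  proof -
    from that have l: "length l = m" "set l \<subseteq> {..<n}" by (auto simp: monotone_indices_def)
    have "(\<Sum>k<m. Suc m ^ (l ! k)) = sum_list (map (\<lambda>i. Suc m ^ i) l)"
      using l(1) by (simp add: sum_list_sum_nth atLeast0LessThan)
    also have "\<dots> = (\<Sum>i<n. count_list l i * Suc m ^ i)"
      using l(2) by (subst sum_list_map_eq_sum_count2[of l "{..<n}"]) auto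
    finally show ?thesis .
  qed
  have lt: "count_list l i < Suc m" if "l \<in> monotone_indices n m" for l i
    using that count_le_length[of l i] by (auto simp: monotone_indices_def)
  have "count_list j i = count_list j' i" if "i < n" for i
    using digits_unique[of "count_list j" "Suc m" "count_list j'" n i] lt j j' eq that
    by (simp add: count)
  moreover have "count_list j i = count_list j' i" if "\<not> i < n" for i
  proof -
    have "i \<notin> set j" "i \<notin> set j'"
      using that j j' by (auto simp: monotone_indices_def)
    then show ?thesis by (simp add: count_list_0_iff)
  qed
  ultimately have "mset j = mset j'"
    by (intro multiset_eqI) (metis count_mset)
  then show "j = j'"
    using j j' by (metis (no_types, lifting) mem_Collect_eq monotone_indices_def
        properties_for_sort sorted_sort_id)
qed

lemma represents_unique:
  assumes c: "represents n m c P" and d: "represents n m d P"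
  shows "c = d"
proof
  fix j0
  let ?T = "monotone_indices n m"
  let ?e = "\<lambda>j. \<Sum>k<m. Suc m ^ (j ! k)"
  define q where "q = (\<Sum>j\<in>?T. monom (c j - d j) (?e j))"
  have "poly q t = 0" for t
  proof -
    define x where "x = vec n (\<lambda>i. t ^ (Suc m ^ i))"
    have x: "x \<in> carrier_vec n" by (simp add: x_def)
    have e: "t ^ ?e j = (\<Prod>k<m. x $ (j ! k))" if "j \<in> ?T" for j
    proof -
      have "j ! k < n" if "k < m" for k
        using \<open>j \<in> ?T\<close> that nth_mem[of k j] unfolding monotone_indices_def by blast
      then show ?thesis by (simp add: x_def power_sum)
    qed
    have "poly q t = (\<Sum>j\<in>?T. (c j - d j) * (\<Prod>k<m. x $ (j ! k)))"
      unfolding q_def poly_sum poly_monom by (intro sum.cong refl) (simp add: e)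
    also have "\<dots> = P x - P x"
      using c d x unfolding represents_def
      by (simp add: left_diff_distrib sum_subtractf)
    finally show ?thesis by simp
  qed
  then have q: "q = 0" by (simp add: poly_all_0_iff_0[symmetric])
  show "c j0 = d j0"
  proof (cases "j0 \<in> ?T")
    case True
    have "0 = coeff q (?e j0)" by (simp add: q)
    also have "\<dots> = (\<Sum>j\<in>?T. if j = j0 then c j - d j else 0)"
      unfolding q_def coeff_sum coeff_monom
      using inj_onD[OF inj_on_kronecker _ _ True] by (intro sum.cong refl) auto
    also have "\<dots> = c j0 - d j0"
      using True finite_monotone_indices by simp
    finally show ?thesis by simp
  next
    case False
    then show ?thesis using c d by (simp add: represents_def)
  qed
qed

lemma represents_coefficients:
  assumes "homogeneous_polynomial n m P"
  shows "represents n m (coefficients n m P) P"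
  using assms represents_unique unfolding homogeneous_polynomial_def coefficients_def
  by (metis theI)

end

theory Submission
  imports Defs "HOL-Analysis.Convex"
begin

text \<open>
  The form \<open>L\<^sub>P\<close> is the symmetric form of \<open>P\<close> with its coefficients restricted to monotone
  indices and corrected by multinomial factors. Both operations are controlled by two-variable
  Schur multipliers.

  Write \<open>T(X) = \<Sum>\<^sub>j \<Sum>\<^sub>f c\<^sub>j \<Prod>\<^sub>k X\<^bsub>f(k)\<^esub>(j\<^sub>k)\<close>, with \<open>f\<close> ranging over the permutations of
  the \<open>m\<close> arguments; this is \<open>m!\<close> times the symmetric form. Averaging \<open>P\<close> over sign combinations of
  the arguments gives \<open>|T| \<le> m\<^sup>m sup |P|\<close> on any unit ball (\<open>polarization\<close>).

  Next, sort the indices \<open>i\<close> of the coefficients of \<open>T\<close> by their ascent pattern: for a set \<open>D\<close> of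
  positions keep those \<open>i\<close> with \<open>i\<^sub>k < i\<^bsub>k+1\<^esub>\<close> for \<open>k \<in> D\<close> and \<open>i\<^sub>k = i\<^bsub>k+1\<^esub>\<close> for \<open>k \<notin> D\<close>. Each
  of the \<open>m - 1\<close> conditions multiplies the coefficients by a function of two neighbouring indices
  only, so with the other arguments held fixed it is the truncation of a bilinear form to its
  diagonal or to its strict upper triangle. The first does not increase the supremum, the second costs a factor
  \<open>\<kappa>\<close> (\<open>pattern_truncation\<close>). What survives is monotone, and on it the coefficient of \<open>T\<close> is \<open>c\<^sub>j\<close>
  times the number of permutations fixing \<open>j\<close>, an integer that is at least 1 and depends on \<open>D\<close>
  alone. Dividing by it and summing over the \<open>2\<^bsup>m-1\<^esup>\<close> patterns bounds \<open>L\<^sub>P\<close> by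
  \<open>2\<^bsup>m-1\<^esup> \<kappa>\<^bsup>m-1\<^esup> m\<^sup>m sup |P|\<close>, and this is at most \<open>(4\<kappa>)\<^bsup>m\<^sup>2\<^esup> sup |P|\<close>, because \<open>m \<le> 2\<^sup>m\<close>
  (\<open>sup_associated_form_le\<close>).

  There remains the cost \<open>\<kappa>\<close> of truncating a bilinear form to the strict upper triangle. For a
  1-unconditional norm, compare binary digits: \<open>a < b\<close> holds iff at the highest digit where they
  differ \<open>a\<close> has 0 and \<open>b\<close> has 1. Each digit contributes a block-diagonal truncation with coordinate
  restrictions, of norm at most 1, so the number \<open>O(log n)\<close> of digits suffices (\<open>multiplier_bound_less\<close>).
  For \<open>\<ell>\<^sub>p\<close> with \<open>p < 2\<close> the argument of Christ and Kiselev removes the logarithm: cut the index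
  interval at a median of \<open>|x|\<^sup>p\<close>. The two rectangles off the diagonal cost 2 in all, and the two halves
  that remain recur with total weight \<open>2\<^bsup>1-2/p\<^esup> < 1\<close>, so the costs form a convergent geometric
  series (\<open>triangular_sum_le\<close>).
\<close>

section \<open>Sign averages\<close>

text \<open>
  Orthogonality of the characters of \<open>{-1, 1}\<^sup>A\<close>: the sum factors over the coordinates, and the factor
  \<open>1 + (-1)\<^bsup>r(k)\<^esup>\<close> at \<open>k\<close> vanishes as soon as the exponent \<open>r(k)\<close> is odd.
\<close>

lemma sum_signs_prod_power:
  fixes r :: "'a \<Rightarrow> nat"
  assumes "finite A"
  shows "(\<Sum>\<epsilon>\<in>A \<rightarrow>\<^sub>E {-1, 1 :: complex}. \<Prod>k\<in>A. \<epsilon> k ^ r k)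
    = (if \<forall>k\<in>A. even (r k) then 2 ^ card A else 0)"
proof -
  have "(\<Sum>\<epsilon>\<in>A \<rightarrow>\<^sub>E {-1, 1 :: complex}. \<Prod>k\<in>A. \<epsilon> k ^ r k)
      = (\<Prod>k\<in>A. \<Sum>s\<in>{-1, 1 :: complex}. s ^ r k)"
    using assms by (intro prod_sum_PiE[symmetric]) auto
  also have "\<dots> = (\<Prod>k\<in>A. if even (r k) then 2 else 0)"
    by (intro prod.cong refl) (auto simp: one_neq_neg_one)
  also have "\<dots> = (if \<forall>k\<in>A. even (r k) then 2 ^ card A else 0)"
    using assms by (auto simp: prod_zero_iff)
  finally show ?thesis .
qed

lemma card_signs: "finite A \<Longrightarrow> card (A \<rightarrow>\<^sub>E {-1, 1 :: complex}) = 2 ^ card A"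
  by (simp add: card_PiE numeral_2_eq_2)

section \<open>Truncation of bilinear forms\<close>

text \<open>
  The relation \<open>R\<close> acts on bilinear forms as a Schur multiplier with values 0 and 1; \<open>\<kappa>\<close> bounds its
  norm for the supremum over \<open>U \<times> U\<close>. Stating this for all matrices \<open>\<beta>\<close> lets it be applied to a
  multilinear form with all but two arguments held fixed.
\<close>

definition multiplier_bound ::
    "complex vec set \<Rightarrow> nat \<Rightarrow> (nat \<Rightarrow> nat \<Rightarrow> bool) \<Rightarrow> real \<Rightarrow> bool" where
  "multiplier_bound U n R \<kappa> \<longleftrightarrow> (\<forall>\<beta> C.
     (\<forall>x\<in>U. \<forall>y\<in>U. cmod (\<Sum>a<n. \<Sum>b<n. \<beta> a b * (x $ a * y $ b)) \<le> C) \<longrightarrow>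
     (\<forall>x\<in>U. \<forall>y\<in>U. cmod (\<Sum>a<n. \<Sum>b<n. of_bool (R a b) * \<beta> a b * (x $ a * y $ b)) \<le> \<kappa> * C))"

lemma multiplier_boundD:
  assumes "multiplier_bound U n R \<kappa>"
    and "\<And>x y. x \<in> U \<Longrightarrow> y \<in> U \<Longrightarrow> cmod (\<Sum>a<n. \<Sum>b<n. \<beta> a b * (x $ a * y $ b)) \<le> C"
    and "x \<in> U" "y \<in> U"
  shows "cmod (\<Sum>a<n. \<Sum>b<n. of_bool (R a b) * \<beta> a b * (x $ a * y $ b)) \<le> \<kappa> * C"
  using assms unfolding multiplier_bound_def by blast

lemma multiplier_bound_cong:
  assumes "multiplier_bound U n R \<kappa>" "\<And>a b. a < n \<Longrightarrow> b < n \<Longrightarrow> R a b = R' a b"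
  shows "multiplier_bound U n R' \<kappa>"
proof -
  have "(\<Sum>a<n. \<Sum>b<n. of_bool (R a b) * \<beta> a b * (x $ a * y $ b))
      = (\<Sum>a<n. \<Sum>b<n. of_bool (R' a b) * \<beta> a b * (x $ a * y $ b))"
    for \<beta> and x y :: "complex vec"
    using assms(2) by (intro sum.cong refl) auto
  then show ?thesis using assms(1) unfolding multiplier_bound_def by simp
qed

lemma multiplier_bound_disjoint_union:
  assumes 1: "multiplier_bound U n R \<kappa>" and 2: "multiplier_bound U n R' \<kappa>'"
    and disj: "\<And>a b. \<not> (R a b \<and> R' a b)"
  shows "multiplier_bound U n (\<lambda>a b. R a b \<or> R' a b) (\<kappa> + \<kappa>')"
  unfolding multiplier_bound_def
proof (intro allI impI ballI)
  fix \<beta> C x y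
  assume B: "\<forall>x\<in>U. \<forall>y\<in>U. cmod (\<Sum>a<n. \<Sum>b<n. \<beta> a b * (x $ a * y $ b)) \<le> C"
    and xy: "x \<in> U" "y \<in> U"
  have split: "of_bool (R a b \<or> R' a b) = (of_bool (R a b) + of_bool (R' a b) :: complex)" for a b
    using disj[of a b] by auto
  have "cmod (\<Sum>a<n. \<Sum>b<n. of_bool (R a b \<or> R' a b) * \<beta> a b * (x $ a * y $ b))
      \<le> cmod (\<Sum>a<n. \<Sum>b<n. of_bool (R a b) * \<beta> a b * (x $ a * y $ b))
       + cmod (\<Sum>a<n. \<Sum>b<n. of_bool (R' a b) * \<beta> a b * (x $ a * y $ b))"
    unfolding split distrib_right sum.distrib by (rule norm_triangle_ineq)
  also have "\<dots> \<le> \<kappa> * C + \<kappa>' * C"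
    using B xy by (intro add_mono multiplier_boundD[OF 1] multiplier_boundD[OF 2]) auto
  finally show "cmod (\<Sum>a<n. \<Sum>b<n. of_bool (R a b \<or> R' a b) * \<beta> a b * (x $ a * y $ b)) \<le> (\<kappa> + \<kappa>') * C"
    by (simp add: algebra_simps)
qed

text \<open>
  What the proof uses of the unit ball of a 1-unconditional norm. Convexity enters only through
  arithmetic means, the case \<open>m = 0\<close> of which, with \<open>0 / 0 = 0\<close>, puts the zero vector into \<open>U\<close>.
\<close>

locale unit_ball =
  fixes n :: nat and U :: "complex vec set"
  assumes carrier: "U \<subseteq> carrier_vec n"
    and solid: "\<And>x y. y \<in> U \<Longrightarrow> x \<in> carrier_vec n \<Longrightarrow> (\<And>k. k < n \<Longrightarrow> cmod (x $ k) \<le> cmod (y $ k)) \<Longrightarrow> x \<in> U"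
    and average: "\<And>m X. (\<And>l. l < m \<Longrightarrow> X l \<in> U) \<Longrightarrow> vec n (\<lambda>a. (\<Sum>l<m. X l $ a) / of_nat m) \<in> U"
    and bounded: "\<exists>R. \<forall>x\<in>U. \<forall>k<n. cmod (x $ k) \<le> R"
begin

lemma scaled_mem:
  assumes "x \<in> U" "\<And>a. a < n \<Longrightarrow> cmod (u a) \<le> 1"
  shows "vec n (\<lambda>a. u a * x $ a) \<in> U"
  using assms by (intro solid[OF assms(1)]) (auto simp: norm_mult mult_left_le_one_le)

text \<open>
  A multiplier that is a mean of products \<open>u(a) v(b)\<close> of functions bounded by 1 does not increase
  the supremum: \<open>u\<close> and \<open>v\<close> can be moved into the arguments, which stay in \<open>U\<close> by solidity.
\<close>

lemma multiplier_bound_factorization: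
  fixes u v :: "'s \<Rightarrow> nat \<Rightarrow> complex"
  assumes S: "finite S" "S \<noteq> {}"
    and fact: "\<And>a b. a < n \<Longrightarrow> b < n \<Longrightarrow>
      (\<Sum>s\<in>S. u s a * v s b) = of_bool (R a b) * of_nat (card S)"
    and u: "\<And>s a. s \<in> S \<Longrightarrow> a < n \<Longrightarrow> cmod (u s a) \<le> 1"
    and v: "\<And>s a. s \<in> S \<Longrightarrow> a < n \<Longrightarrow> cmod (v s a) \<le> 1"
  shows "multiplier_bound U n R 1"
  unfolding multiplier_bound_def
proof (intro allI impI ballI)
  fix \<beta> C x y
  assume B: "\<forall>x\<in>U. \<forall>y\<in>U. cmod (\<Sum>a<n. \<Sum>b<n. \<beta> a b * (x $ a * y $ b)) \<le> C"
    and xy: "x \<in> U" "y \<in> U"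
  have card: "card S > 0" using S by (simp add: card_gt_0_iff)
  define x' where "x' s = vec n (\<lambda>a. u s a * x $ a)" for s
  define y' where "y' s = vec n (\<lambda>a. v s a * y $ a)" for s
  let ?T = "\<Sum>a<n. \<Sum>b<n. of_bool (R a b) * \<beta> a b * (x $ a * y $ b)"
  have "of_nat (card S) * ?T
      = (\<Sum>a<n. \<Sum>b<n. (\<Sum>s\<in>S. u s a * v s b) * (\<beta> a b * (x $ a * y $ b)))"
    unfolding sum_distrib_left using fact by (intro sum.cong refl) (simp add: mult_ac)
  also have "\<dots> = (\<Sum>a<n. \<Sum>b<n. \<Sum>s\<in>S. \<beta> a b * (x' s $ a * y' s $ b))"
    unfolding sum_distrib_right by (intro sum.cong refl) (simp add: x'_def y'_def mult_ac)
  also have "\<dots> = (\<Sum>a<n. \<Sum>s\<in>S. \<Sum>b<n. \<beta> a b * (x' s $ a * y' s $ b))"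
    by (intro sum.cong refl sum.swap)
  also have "\<dots> = (\<Sum>s\<in>S. \<Sum>a<n. \<Sum>b<n. \<beta> a b * (x' s $ a * y' s $ b))"
    by (rule sum.swap)
  also have "cmod \<dots> \<le> (\<Sum>s\<in>S. C)"
  proof (rule sum_norm_le)
    fix s assume "s \<in> S"
    then show "cmod (\<Sum>a<n. \<Sum>b<n. \<beta> a b * (x' s $ a * y' s $ b)) \<le> C"
      using B scaled_mem[OF xy(1)] scaled_mem[OF xy(2)] u v unfolding x'_def y'_def by blast
  qed
  finally show "cmod ?T \<le> 1 * C" using card by (simp add: norm_mult)
qed

text \<open>
  The indicator of \<open>\<phi> a = \<phi> b\<close> is the mean of \<open>\<epsilon>(\<phi> a) \<epsilon>(\<phi> b)\<close> over all signs \<open>\<epsilon>\<close>. The predicates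
  \<open>p\<close> and \<open>q\<close> restrict the two arguments to subsets of the coordinates.
\<close>

lemma multiplier_bound_blocks:
  fixes \<phi> :: "nat \<Rightarrow> 'b"
  shows "multiplier_bound U n (\<lambda>a b. \<phi> a = \<phi> b \<and> p a \<and> q b) 1"
proof (rule multiplier_bound_factorization)
  let ?A = "\<phi> ` {..<n}"
  let ?S = "?A \<rightarrow>\<^sub>E {-1, 1 :: complex}"
  show "finite ?S" by (intro finite_PiE) auto
  show "?S \<noteq> {}" by (simp add: PiE_eq_empty_iff)
  have unit: "cmod (\<epsilon> k) = 1" if "\<epsilon> \<in> ?S" "k \<in> ?A" for \<epsilon> k
    using PiE_mem[OF that] by auto
  show "cmod (of_bool (p a) * \<epsilon> (\<phi> a)) \<le> 1" if "\<epsilon> \<in> ?S" "a < n" for \<epsilon> a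
    using unit[OF that(1), of "\<phi> a"] that by simp
  show "cmod (of_bool (q a) * \<epsilon> (\<phi> a)) \<le> 1" if "\<epsilon> \<in> ?S" "a < n" for \<epsilon> a
    using unit[OF that(1), of "\<phi> a"] that by simp
  show "(\<Sum>\<epsilon>\<in>?S. of_bool (p a) * \<epsilon> (\<phi> a) * (of_bool (q b) * \<epsilon> (\<phi> b)))
      = of_bool (\<phi> a = \<phi> b \<and> p a \<and> q b) * of_nat (card ?S)" if ab: "a < n" "b < n" for a b
  proof -
    let ?r = "\<lambda>k. of_bool (k = \<phi> a) + of_bool (k = \<phi> b) :: nat"
    have single: "(\<Prod>k\<in>?A. \<epsilon> k ^ of_bool (k = \<phi> c)) = \<epsilon> (\<phi> c)" if "c < n"
      for \<epsilon> :: "'b \<Rightarrow> complex" and c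
    proof -
      have "(\<Prod>k\<in>?A. \<epsilon> k ^ of_bool (k = \<phi> c)) = (\<Prod>k\<in>?A. if k = \<phi> c then \<epsilon> k else 1)"
        by (intro prod.cong) auto
      then show ?thesis using that by (simp add: prod.delta)
    qed
    have "(\<Sum>\<epsilon>\<in>?S. \<epsilon> (\<phi> a) * \<epsilon> (\<phi> b)) = (\<Sum>\<epsilon>\<in>?S. \<Prod>k\<in>?A. \<epsilon> k ^ ?r k)"
      using single ab by (simp add: power_add prod.distrib)
    also have "\<dots> = (if \<forall>k\<in>?A. even (?r k) then 2 ^ card ?A else 0)"
      by (rule sum_signs_prod_power) simp
    also have "(\<forall>k\<in>?A. even (?r k)) \<longleftrightarrow> \<phi> a = \<phi> b"
      using ab by (auto split: if_splits)
    finally have "(\<Sum>\<epsilon>\<in>?S. \<epsilon> (\<phi> a) * \<epsilon> (\<phi> b)) = of_bool (\<phi> a = \<phi> b) * of_nat (card ?S)"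
      by (simp add: card_signs)
    moreover have "(\<Sum>\<epsilon>\<in>?S. of_bool (p a) * \<epsilon> (\<phi> a) * (of_bool (q b) * \<epsilon> (\<phi> b)))
        = of_bool (p a \<and> q b) * (\<Sum>\<epsilon>\<in>?S. \<epsilon> (\<phi> a) * \<epsilon> (\<phi> b))"
      by (auto simp: sum_distrib_left mult_ac)
    ultimately show ?thesis by auto
  qed
qed

text \<open>
  Passing from blocks of length \<open>2\<^sup>L\<close> to blocks of length \<open>2\<^bsup>L+1\<^esup>\<close> adds the pairs with \<open>a\<close> in the
  left half and \<open>b\<close> in the right half of the same block. These form a block-diagonal multiplier,
  which costs 1.
\<close>

lemma multiplier_bound_less_dyadic:
  "multiplier_bound U n (\<lambda>a b. a < b \<and> a div 2 ^ L = b div 2 ^ L) (real L)"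
proof (induction L)
  case 0
  have empty: "(a < b \<and> a div 2 ^ 0 = b div 2 ^ 0) = False" for a b :: nat by simp
  show ?case unfolding empty by (simp add: multiplier_bound_def)
next
  case (Suc L)
  have "multiplier_bound U n
     (\<lambda>a b. (a < b \<and> a div 2 ^ L = b div 2 ^ L) \<or>
        (a div 2 ^ L div 2 = b div 2 ^ L div 2 \<and> even (a div 2 ^ L) \<and> odd (b div 2 ^ L)))
     (real L + 1)"
    by (intro multiplier_bound_disjoint_union Suc.IH
        multiplier_bound_blocks[where \<phi> = "\<lambda>a. a div 2 ^ L div 2"
          and p = "\<lambda>a. even (a div 2 ^ L)" and q = "\<lambda>b. odd (b div 2 ^ L)"]) auto
  moreover have "(a < b \<and> a div 2 ^ L = b div 2 ^ L) \<or>
        (a div 2 ^ L div 2 = b div 2 ^ L div 2 \<and> even (a div 2 ^ L) \<and> odd (b div 2 ^ L))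
      \<longleftrightarrow> a < b \<and> a div 2 ^ Suc L = b div 2 ^ Suc L" for a b :: nat
  proof -
    define \<alpha> \<beta> where "\<alpha> = a div 2 ^ L" and "\<beta> = b div 2 ^ L"
    have lt: "a < b" if "\<alpha> < \<beta>"
      using that unfolding \<alpha>_def \<beta>_def by (meson div_le_mono leD leI)
    have le: "\<alpha> \<le> \<beta>" if "a < b"
      using that unfolding \<alpha>_def \<beta>_def by (simp add: div_le_mono)
    have "\<alpha> div 2 = \<beta> div 2 \<and> even \<alpha> \<and> odd \<beta> \<longleftrightarrow> \<alpha> div 2 = \<beta> div 2 \<and> \<alpha> < \<beta>"
      by presburger
    then have "(a < b \<and> \<alpha> = \<beta>) \<or> (\<alpha> div 2 = \<beta> div 2 \<and> even \<alpha> \<and> odd \<beta>)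
       \<longleftrightarrow> a < b \<and> \<alpha> div 2 = \<beta> div 2"
      using lt le by (metis le_neq_implies_less)
    moreover have "a div 2 ^ Suc L = \<alpha> div 2" "b div 2 ^ Suc L = \<beta> div 2"
      unfolding \<alpha>_def \<beta>_def by (simp_all only: power_Suc2 div_mult2_eq)
    ultimately show ?thesis unfolding \<alpha>_def[symmetric] \<beta>_def[symmetric] by simp
  qed
  ultimately show ?case by (simp add: add.commute)
qed

corollary multiplier_bound_less:
  assumes "n \<le> 2 ^ L"
  shows "multiplier_bound U n (<) (real L)"
  using multiplier_bound_less_dyadic[of L]
  by (rule multiplier_bound_cong) (use assms in auto)

end

section \<open>Truncation of multilinear forms in two variables\<close>

lemma sum_pick_pair:
  fixes g :: "nat \<Rightarrow> nat \<Rightarrow> 'a :: comm_semiring_1"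
  assumes "a < n" "b < n"
  shows "(\<Sum>a'<n. \<Sum>b'<n. of_bool (a = a' \<and> b = b') * g a' b') = g a b"
proof -
  have "(\<Sum>b'<n. of_bool (a = a' \<and> b = b') * g a' b') = (if a = a' then g a b else 0)" for a'
  proof -
    have "(\<Sum>b'<n. of_bool (a = a' \<and> b = b') * g a' b')
        = (\<Sum>b'<n. if b = b' then (if a = a' then g a b else 0) else 0)"
      by (intro sum.cong) auto
    then show ?thesis using assms by (simp add: sum.delta')
  qed
  then show ?thesis using assms by (simp add: sum.delta')
qed

text \<open>
  With the arguments other than \<open>r\<close> and \<open>q\<close> fixed, the sum is a bilinear form in the \<open>r\<close>-th and \<open>q\<close>-th
  argument, and the indicator depends on the two indices of these arguments only. The index set \<open>I\<close>
  with its coordinate functions \<open>e i\<close> is arbitrary, so that several terms may carry the same index.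
\<close>

lemma multiplier_bound_multilinear:
  fixes e :: "'i \<Rightarrow> nat \<Rightarrow> nat"
  assumes R: "multiplier_bound U n R \<kappa>" and I: "finite I"
    and e: "\<And>i l. i \<in> I \<Longrightarrow> l < m \<Longrightarrow> e i l < n"
    and rq: "r \<noteq> q" "r < m" "q < m"
    and C: "\<And>X. (\<And>l. l < m \<Longrightarrow> X l \<in> U) \<Longrightarrow> cmod (\<Sum>i\<in>I. s i * (\<Prod>l<m. X l $ e i l)) \<le> C"
    and X: "\<And>l. l < m \<Longrightarrow> X l \<in> U"
  shows "cmod (\<Sum>i\<in>I. of_bool (R (e i r) (e i q)) * s i * (\<Prod>l<m. X l $ e i l)) \<le> \<kappa> * C"
proof -
  define h where "h i = s i * (\<Prod>l\<in>{..<m} - {r} - {q}. X l $ e i l)" for i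
  define \<beta> where "\<beta> a b = (\<Sum>i\<in>I. of_bool (e i r = a \<and> e i q = b) * h i)" for a b
  \<comment> \<open>For any weight \<open>w\<close>, grouping the terms by their \<open>r\<close>-th and \<open>q\<close>-th index gives the matrix \<open>\<beta>\<close>.
      It is used with the constant weight 1 and with the indicator of \<open>R\<close>.\<close>
  have collect: "(\<Sum>a<n. \<Sum>b<n. w a b * \<beta> a b * (x $ a * y $ b))
      = (\<Sum>i\<in>I. w (e i r) (e i q) * s i * (\<Prod>l<m. (X(r := x, q := y)) l $ e i l))"
    for w :: "nat \<Rightarrow> nat \<Rightarrow> complex" and x y
  proof -
    have "(\<Sum>a<n. \<Sum>b<n. w a b * \<beta> a b * (x $ a * y $ b))
        = (\<Sum>a<n. \<Sum>b<n. \<Sum>i\<in>I. of_bool (e i r = a \<and> e i q = b) * (w a b * h i * (x $ a * y $ b)))"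
      unfolding \<beta>_def sum_distrib_left sum_distrib_right by (simp add: mult_ac)
    also have "\<dots> = (\<Sum>a<n. \<Sum>i\<in>I. \<Sum>b<n. of_bool (e i r = a \<and> e i q = b) * (w a b * h i * (x $ a * y $ b)))"
      by (intro sum.cong refl sum.swap)
    also have "\<dots> = (\<Sum>i\<in>I. \<Sum>a<n. \<Sum>b<n. of_bool (e i r = a \<and> e i q = b) * (w a b * h i * (x $ a * y $ b)))"
      by (rule sum.swap)
    also have "\<dots> = (\<Sum>i\<in>I. w (e i r) (e i q) * h i * (x $ e i r * y $ e i q))"
      using e rq by (intro sum.cong refl sum_pick_pair) auto
    also have "\<dots> = (\<Sum>i\<in>I. w (e i r) (e i q) * s i * (\<Prod>l<m. (X(r := x, q := y)) l $ e i l))"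
    proof (intro sum.cong refl)
      fix i
      let ?f = "\<lambda>l. (X(r := x, q := y)) l $ e i l"
      have "(\<Prod>l<m. ?f l) = ?f r * (?f q * prod ?f ({..<m} - {r} - {q}))"
        using rq by (simp add: prod.remove[of "{..<m}" r] prod.remove[of "{..<m} - {r}" q])
      also have "prod ?f ({..<m} - {r} - {q}) = (\<Prod>l\<in>{..<m} - {r} - {q}. X l $ e i l)"
        by (intro prod.cong) auto
      finally have prod: "(\<Prod>l<m. ?f l) = ?f r * (?f q * (\<Prod>l\<in>{..<m} - {r} - {q}. X l $ e i l))" .
      have ends: "?f r = x $ e i r" "?f q = y $ e i q" using rq by simp_all
      show "w (e i r) (e i q) * h i * (x $ e i r * y $ e i q)
          = w (e i r) (e i q) * s i * (\<Prod>l<m. ?f l)"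
        unfolding prod ends h_def by (simp only: mult_ac)
    qed
    finally show ?thesis .
  qed
  have "cmod (\<Sum>a<n. \<Sum>b<n. \<beta> a b * (x $ a * y $ b)) \<le> C" if "x \<in> U" "y \<in> U" for x y
  proof -
    have "(\<Sum>a<n. \<Sum>b<n. \<beta> a b * (x $ a * y $ b)) = (\<Sum>i\<in>I. s i * (\<Prod>l<m. (X(r := x, q := y)) l $ e i l))"
      using collect[of "\<lambda>_ _. 1" x y] by simp
    also have "cmod \<dots> \<le> C" using that X by (intro C) auto
    finally show ?thesis .
  qed
  from multiplier_boundD[OF R this X[OF rq(2)] X[OF rq(3)]]
  show ?thesis by (simp add: collect)
qed

section \<open>Polarization\<close>

definition bijections :: "nat \<Rightarrow> (nat \<Rightarrow> nat) set" where
  "bijections m = {f \<in> {..<m} \<rightarrow>\<^sub>E {..<m}. bij_betw f {..<m} {..<m}}"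

lemma finite_bijections: "finite (bijections m)"
  unfolding bijections_def by (rule finite_subset[of _ "{..<m} \<rightarrow>\<^sub>E {..<m}"]) (auto intro: finite_PiE)

text \<open>
  The sign attached to \<open>l\<close> occurs \<open>1 + |f\<^sup>-\<^sup>1(l)|\<close> times. All these exponents are even only if every
  fibre of \<open>f\<close> is nonempty, that is, if \<open>f\<close> permutes \<open>{..<m}\<close>.
\<close>

lemma sum_signs_map:
  assumes f: "f \<in> {..<m} \<rightarrow>\<^sub>E {..<m}"
  shows "(\<Sum>\<epsilon>\<in>{..<m} \<rightarrow>\<^sub>E {-1, 1 :: complex}. (\<Prod>l<m. \<epsilon> l) * (\<Prod>k<m. \<epsilon> (f k)))
    = of_bool (f \<in> bijections m) * 2 ^ m"
proof -
  let ?r = "\<lambda>l. Suc (card {k \<in> {..<m}. f k = l})"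
  have fm: "f ` {..<m} \<subseteq> {..<m}" using f by auto
  have "(\<Prod>k<m. \<epsilon> (f k)) = (\<Prod>l<m. \<epsilon> l ^ card {k \<in> {..<m}. f k = l})" for \<epsilon> :: "nat \<Rightarrow> complex"
  proof -
    have "(\<Prod>k<m. \<epsilon> (f k)) = (\<Prod>l<m. \<Prod>k\<in>{k \<in> {..<m}. f k = l}. \<epsilon> (f k))"
      using fm by (intro prod.group[symmetric]) auto
    also have "\<dots> = (\<Prod>l<m. \<Prod>k\<in>{k \<in> {..<m}. f k = l}. \<epsilon> l)"
      by (intro prod.cong refl) auto
    finally show ?thesis by simp
  qed
  then have "(\<Sum>\<epsilon>\<in>{..<m} \<rightarrow>\<^sub>E {-1, 1 :: complex}. (\<Prod>l<m. \<epsilon> l) * (\<Prod>k<m. \<epsilon> (f k)))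
      = (\<Sum>\<epsilon>\<in>{..<m} \<rightarrow>\<^sub>E {-1, 1 :: complex}. \<Prod>l<m. \<epsilon> l ^ ?r l)"
    by (simp add: prod.distrib)
  also have "\<dots> = (if \<forall>l\<in>{..<m}. even (?r l) then 2 ^ m else 0)"
    by (subst sum_signs_prod_power) simp_all
  also have "(\<forall>l\<in>{..<m}. even (?r l)) \<longleftrightarrow> f \<in> bijections m"
  proof
    assume ev: "\<forall>l\<in>{..<m}. even (?r l)"
    have "{..<m} \<subseteq> f ` {..<m}"
    proof
      fix l assume "l \<in> {..<m}"
      then have "{k \<in> {..<m}. f k = l} \<noteq> {}" using ev by (metis card.empty even_Suc even_zero)
      then show "l \<in> f ` {..<m}" by auto
    qed
    then have "inj_on f {..<m}" "f ` {..<m} = {..<m}" using fm by (auto intro: finite_surj_inj)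
    then show "f \<in> bijections m" using f by (simp add: bijections_def bij_betw_def)
  next
    assume "f \<in> bijections m"
    then have f': "inj_on f {..<m}" "f ` {..<m} = {..<m}" by (auto simp: bijections_def bij_betw_def)
    show "\<forall>l\<in>{..<m}. even (?r l)"
    proof
      fix l assume "l \<in> {..<m}"
      then obtain k where k: "k < m" "f k = l" using f'(2) by (metis imageE lessThan_iff)
      then have "{k \<in> {..<m}. f k = l} = {k}" using f'(1) by (auto dest: inj_onD)
      then show "even (?r l)" by simp
    qed
  qed
  finally show ?thesis by simp
qed

lemma monotone_indices_nth_less: "j \<in> monotone_indices n m \<Longrightarrow> k < m \<Longrightarrow> j ! k < n"
  unfolding monotone_indices_def using nth_mem by blast

text \<open>
  Expand \<open>P(\<Sum>\<^sub>l \<epsilon>\<^sub>l X\<^sub>l)\<close> into a sum over all maps \<open>f\<close> from factors to arguments. The mean against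
  \<open>\<Prod>\<^sub>l \<epsilon>\<^sub>l\<close> keeps the bijective \<open>f\<close>. The factor \<open>m\<^sup>m\<close> comes from homogeneity, since it is
  \<open>(\<Sum>\<^sub>l \<epsilon>\<^sub>l X\<^sub>l) / m\<close> that lies in \<open>U\<close>.
\<close>

lemma (in unit_ball) polarization:
  assumes P: "represents n m c P" and B: "\<And>x. x \<in> U \<Longrightarrow> cmod (P x) \<le> B"
    and X: "\<And>l. l < m \<Longrightarrow> X l \<in> U"
  shows "cmod (\<Sum>j\<in>monotone_indices n m. \<Sum>f\<in>bijections m. c j * (\<Prod>k<m. X (f k) $ (j ! k)))
    \<le> real m ^ m * B"
proof -
  let ?J = "monotone_indices n m"
  let ?E = "{..<m} \<rightarrow>\<^sub>E {-1, 1 :: complex}"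
  let ?F = "{..<m} \<rightarrow>\<^sub>E {..<m}"
  let ?T = "\<Sum>j\<in>?J. \<Sum>f\<in>bijections m. c j * (\<Prod>k<m. X (f k) $ (j ! k))"
  define v where "v \<epsilon> = vec n (\<lambda>a. (\<Sum>l<m. \<epsilon> l * X l $ a) / of_nat m)" for \<epsilon> :: "nat \<Rightarrow> complex"
  have unit: "cmod (\<epsilon> l) = 1" if "\<epsilon> \<in> ?E" "l < m" for \<epsilon> l
    using PiE_mem[OF that(1), of l] that(2) by auto
  have v: "v \<epsilon> \<in> U" if "\<epsilon> \<in> ?E" for \<epsilon>
  proof -
    have "vec n (\<lambda>a. (\<Sum>l<m. vec n (\<lambda>a. \<epsilon> l * X l $ a) $ a) / of_nat m) \<in> U"
      using X unit[OF that] by (intro average scaled_mem) auto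
    also have "vec n (\<lambda>a. (\<Sum>l<m. vec n (\<lambda>a. \<epsilon> l * X l $ a) $ a) / of_nat m) = v \<epsilon>"
      unfolding v_def by (intro eq_vecI) auto
    finally show ?thesis .
  qed
  have fin: "finite ?F" by (intro finite_PiE) auto
  have expand: "of_nat m ^ m * P (v \<epsilon>)
      = (\<Sum>j\<in>?J. \<Sum>f\<in>?F. c j * (\<Prod>k<m. X (f k) $ (j ! k)) * (\<Prod>k<m. \<epsilon> (f k)))"
    if \<epsilon>: "\<epsilon> \<in> ?E" for \<epsilon>
  proof -
    have "of_nat m ^ m * P (v \<epsilon>) = (\<Sum>j\<in>?J. c j * (of_nat m ^ m * (\<Prod>k<m. v \<epsilon> $ (j ! k))))"
      using P v[OF \<epsilon>] carrier by (auto simp: represents_def sum_distrib_left mult_ac)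
    also have "\<dots> = (\<Sum>j\<in>?J. c j * (\<Prod>k<m. \<Sum>l<m. \<epsilon> l * X l $ (j ! k)))"
    proof (intro sum.cong refl arg_cong2[where f = "(*)"])
      fix j assume j: "j \<in> ?J"
      have "of_nat m ^ m * (\<Prod>k<m. v \<epsilon> $ (j ! k)) = (\<Prod>k<m. of_nat m * v \<epsilon> $ (j ! k))"
        by (simp add: prod.distrib)
      also have "\<dots> = (\<Prod>k<m. \<Sum>l<m. \<epsilon> l * X l $ (j ! k))"
        using monotone_indices_nth_less[OF j] by (intro prod.cong refl) (auto simp: v_def)
      finally show "of_nat m ^ m * (\<Prod>k<m. v \<epsilon> $ (j ! k)) = (\<Prod>k<m. \<Sum>l<m. \<epsilon> l * X l $ (j ! k))" .
    qed
    also have "\<dots> = (\<Sum>j\<in>?J. c j * (\<Sum>f\<in>?F. \<Prod>k<m. \<epsilon> (f k) * X (f k) $ (j ! k)))"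
      by (subst prod_sum_PiE) auto
    finally show ?thesis by (simp add: sum_distrib_left prod.distrib mult_ac)
  qed
  have "(\<Sum>\<epsilon>\<in>?E. (\<Prod>l<m. \<epsilon> l) * (of_nat m ^ m * P (v \<epsilon>)))
      = (\<Sum>\<epsilon>\<in>?E. \<Sum>j\<in>?J. \<Sum>f\<in>?F. c j * (\<Prod>k<m. X (f k) $ (j ! k)) * ((\<Prod>l<m. \<epsilon> l) * (\<Prod>k<m. \<epsilon> (f k))))"
    by (intro sum.cong refl) (subst expand, assumption, simp add: sum_distrib_left mult_ac)
  also have "\<dots> = (\<Sum>j\<in>?J. \<Sum>\<epsilon>\<in>?E. \<Sum>f\<in>?F. c j * (\<Prod>k<m. X (f k) $ (j ! k)) * ((\<Prod>l<m. \<epsilon> l) * (\<Prod>k<m. \<epsilon> (f k))))"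
    by (rule sum.swap)
  also have "\<dots> = (\<Sum>j\<in>?J. \<Sum>f\<in>?F. \<Sum>\<epsilon>\<in>?E. c j * (\<Prod>k<m. X (f k) $ (j ! k)) * ((\<Prod>l<m. \<epsilon> l) * (\<Prod>k<m. \<epsilon> (f k))))"
    by (intro sum.cong refl sum.swap)
  also have "\<dots> = (\<Sum>j\<in>?J. \<Sum>f\<in>?F. c j * (\<Prod>k<m. X (f k) $ (j ! k)) * (of_bool (f \<in> bijections m) * 2 ^ m))"
    unfolding sum_distrib_left[symmetric] by (intro sum.cong refl) (simp add: sum_signs_map)
  also have "\<dots> = (\<Sum>j\<in>?J. \<Sum>f\<in>bijections m. c j * (\<Prod>k<m. X (f k) $ (j ! k)) * (of_bool (f \<in> bijections m) * 2 ^ m))"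
    by (rule sum.cong[OF refl], rule sum.mono_neutral_right[OF fin]) (auto simp: bijections_def)
  also have "\<dots> = 2 ^ m * ?T"
    unfolding sum_distrib_left by (intro sum.cong refl) simp
  finally have T: "2 ^ m * ?T = (\<Sum>\<epsilon>\<in>?E. (\<Prod>l<m. \<epsilon> l) * (of_nat m ^ m * P (v \<epsilon>)))" by simp
  have "2 ^ m * cmod ?T = cmod (2 ^ m * ?T)" by (simp add: norm_mult norm_power)
  also have "\<dots> \<le> (\<Sum>\<epsilon>\<in>?E. real m ^ m * B)"
    unfolding T
  proof (rule sum_norm_le)
    fix \<epsilon> assume \<epsilon>: "\<epsilon> \<in> ?E"
    have "cmod (\<Prod>l<m. \<epsilon> l) = 1" using unit[OF \<epsilon>] by (simp add: prod_norm[symmetric])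
    then show "cmod ((\<Prod>l<m. \<epsilon> l) * (of_nat m ^ m * P (v \<epsilon>))) \<le> real m ^ m * B"
      using B[OF v[OF \<epsilon>]] by (simp add: norm_mult norm_power mult_left_mono)
  qed
  also have "\<dots> = 2 ^ m * (real m ^ m * B)" by (simp add: card_signs)
  finally show ?thesis by simp
qed

section \<open>Ascent patterns of indices\<close>

text \<open>
  The parameter \<open>r\<close> counts the conditions imposed so far, so that they can be imposed one at a time.
\<close>

definition ascent_pattern :: "nat set \<Rightarrow> nat \<Rightarrow> (nat \<Rightarrow> nat) \<Rightarrow> bool" where
  "ascent_pattern D r i \<longleftrightarrow> (\<forall>k<r. if k \<in> D then i k < i (Suc k) else i k = i (Suc k))"

lemma ascent_pattern_Suc:
  "ascent_pattern D (Suc r) i \<longleftrightarrow>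
     ascent_pattern D r i \<and> (if r \<in> D then i r < i (Suc r) else i r = i (Suc r))"
  unfolding ascent_pattern_def by (auto simp: less_Suc_eq)

lemma ascent_pattern_mono_eq:
  assumes D: "ascent_pattern D r i" and ab: "a \<le> b" "b \<le> r"
  shows "i a \<le> i b \<and> (i a = i b \<longleftrightarrow> (\<forall>k. a \<le> k \<and> k < b \<longrightarrow> k \<notin> D))"
  using ab
proof (induction b rule: dec_induct)
  case base
  then show ?case by auto
next
  case (step b)
  have "if b \<in> D then i b < i (Suc b) else i b = i (Suc b)"
    using D step.prems unfolding ascent_pattern_def by simp
  moreover have "(\<forall>k. a \<le> k \<and> k < Suc b \<longrightarrow> k \<notin> D) \<longleftrightarrow> (\<forall>k. a \<le> k \<and> k < b \<longrightarrow> k \<notin> D) \<and> b \<notin> D"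
    using step.hyps by (auto simp: less_Suc_eq)
  ultimately show ?case using step.IH step.prems by (cases "b \<in> D") auto
qed

lemma ascent_pattern_eq_iff:
  assumes "ascent_pattern D r i" "ascent_pattern D r i'" "a \<le> r" "b \<le> r"
  shows "i a = i b \<longleftrightarrow> i' a = i' b"
proof (cases "a \<le> b")
  case True
  then show ?thesis
    using ascent_pattern_mono_eq[OF assms(1), of a b] ascent_pattern_mono_eq[OF assms(2), of a b] assms(4)
    by simp
next
  case False
  then have "i b = i a \<longleftrightarrow> i' b = i' a"
    using ascent_pattern_mono_eq[OF assms(1), of b a] ascent_pattern_mono_eq[OF assms(2), of b a] assms(3)
    by simp
  then show ?thesis by (simp add: eq_commute)
qed

lemma ascents_unique_pattern:
  assumes j: "j \<in> monotone_indices n m"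
  shows "ascent_pattern D (m - 1) ((!) j) \<and> D \<subseteq> {..<m - 1}
    \<longleftrightarrow> D = {k. k < m - 1 \<and> j ! k < j ! Suc k}"
proof -
  have "j ! k \<le> j ! Suc k" if "k < m - 1" for k
    using j that by (auto simp: monotone_indices_def sorted_iff_nth_mono)
  note nth_le = this
  show ?thesis
  proof
    assume D: "ascent_pattern D (m - 1) ((!) j) \<and> D \<subseteq> {..<m - 1}"
    have "k \<in> D \<longleftrightarrow> k < m - 1 \<and> j ! k < j ! Suc k" for k
    proof (cases "k < m - 1")
      case True
      then have "if k \<in> D then j ! k < j ! Suc k else j ! k = j ! Suc k"
        using D unfolding ascent_pattern_def by blast
      with True show ?thesis by (simp split: if_splits)
    next
      case False
      with D show ?thesis by auto
    qed
    then show "D = {k. k < m - 1 \<and> j ! k < j ! Suc k}" by blast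
  next
    assume D: "D = {k. k < m - 1 \<and> j ! k < j ! Suc k}"
    then show "ascent_pattern D (m - 1) ((!) j) \<and> D \<subseteq> {..<m - 1}"
      unfolding ascent_pattern_def using nth_le by (auto simp: le_less)
  qed
qed

lemma inv_into_bijection:
  assumes "f \<in> bijections m"
  shows "bij_betw f {..<m} {..<m}" "bij_betw (inv_into {..<m} f) {..<m} {..<m}"
  using assms bij_betw_inv_into by (auto simp: bijections_def)

text \<open>
  An index with an ascent pattern is weakly increasing, and a sorted list has no other increasing
  rearrangement than itself.
\<close>

lemma sorted_rearrangement_eq:
  assumes j: "j \<in> monotone_indices n m" and g: "bij_betw g {..<m} {..<m}"
    and D: "ascent_pattern D (m - 1) (\<lambda>l. j ! g l)" and l: "l < m"
  shows "j ! g l = j ! l"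
proof -
  have len: "length j = m" and srt: "sorted j" using j by (auto simp: monotone_indices_def)
  let ?i = "map (\<lambda>l. j ! g l) [0..<m]"
  have "sorted ?i"
    unfolding sorted_iff_nth_mono
    using ascent_pattern_mono_eq[OF D] by fastforce
  moreover have "mset ?i = mset j"
  proof -
    have "mset ?i = image_mset (\<lambda>l. j ! g l) (mset_set {..<m})"
      by (simp add: atLeast0LessThan[symmetric])
    also have "\<dots> = image_mset ((!) j) (image_mset g (mset_set {..<m}))"
      by (simp add: image_mset.compositionality comp_def)
    also have "image_mset g (mset_set {..<m}) = mset_set {..<m}"
      using g by (simp add: image_mset_mset_set bij_betw_def)
    also have "image_mset ((!) j) (mset_set {..<m}) = mset (map ((!) j) [0..<m])"
      by (simp add: atLeast0LessThan[symmetric])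
    also have "map ((!) j) [0..<m] = j" using len by (simp add: map_nth flip: len)
    finally show ?thesis .
  qed
  ultimately have "?i = j" using srt by (metis properties_for_sort)
  then have "?i ! l = j ! l" by simp
  then show ?thesis using l by simp
qed

definition stabilizer :: "nat \<Rightarrow> nat list \<Rightarrow> (nat \<Rightarrow> nat) set" where
  "stabilizer m j = {f \<in> bijections m. \<forall>l<m. j ! inv_into {..<m} f l = j ! l}"

lemma card_stabilizer_pos: "card (stabilizer m j) > 0"
proof -
  let ?f = "restrict (\<lambda>k. k) {..<m}"
  have bij: "bij_betw ?f {..<m} {..<m}" by (simp add: bij_betw_def inj_on_def)
  have "inv_into {..<m} ?f l = l" if "l < m" for l
    using inv_into_f_f[of ?f "{..<m}" l] that by (simp add: inj_on_def)
  then have "?f \<in> stabilizer m j" using bij by (auto simp: stabilizer_def bijections_def)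
  moreover have "finite (stabilizer m j)"
    using finite_bijections by (simp add: stabilizer_def)
  ultimately show ?thesis by (auto simp: card_gt_0_iff)
qed

text \<open>
  The stabilizer depends only on which entries of \<open>j\<close> coincide, and the pattern determines that.
\<close>

lemma stabilizer_cong_pattern:
  assumes "ascent_pattern D (m - 1) ((!) j)" "ascent_pattern D (m - 1) ((!) j')"
  shows "stabilizer m j = stabilizer m j'"
proof -
  have "j ! inv_into {..<m} f l = j ! l \<longleftrightarrow> j' ! inv_into {..<m} f l = j' ! l"
    if f: "f \<in> bijections m" and l: "l < m" for f l
  proof -
    have "inv_into {..<m} f l < m"
      using bij_betwE[OF inv_into_bijection(2)[OF f]] l by auto
    then show ?thesis using l ascent_pattern_eq_iff[OF assms, of "inv_into {..<m} f l" l] by simp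
  qed
  then show ?thesis unfolding stabilizer_def by blast
qed

text \<open>
  Among the rearrangements of a sorted index \<open>j\<close> only \<open>j\<close> itself can have the pattern \<open>D\<close>, and it
  arises from exactly the permutations in the stabilizer.
\<close>

lemma sum_pattern_symmetrized:
  fixes c :: "nat list \<Rightarrow> complex" and X :: "nat \<Rightarrow> complex vec"
  assumes j: "j \<in> monotone_indices n m"
  shows "(\<Sum>f\<in>bijections m. of_bool (ascent_pattern D (m - 1) (\<lambda>l. j ! inv_into {..<m} f l))
        * c j * (\<Prod>l<m. X l $ (j ! inv_into {..<m} f l)))
    = of_nat (card (stabilizer m j)) *
        (of_bool (ascent_pattern D (m - 1) ((!) j)) * c j * (\<Prod>l<m. X l $ (j ! l)))"
proof -
  have "(\<Sum>f\<in>bijections m. of_bool (ascent_pattern D (m - 1) (\<lambda>l. j ! inv_into {..<m} f l))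
        * c j * (\<Prod>l<m. X l $ (j ! inv_into {..<m} f l)))
    = (\<Sum>f\<in>bijections m. if f \<in> stabilizer m j
        then of_bool (ascent_pattern D (m - 1) ((!) j)) * c j * (\<Prod>l<m. X l $ (j ! l)) else 0)"
  proof (intro sum.cong refl)
    fix f assume f: "f \<in> bijections m"
    let ?i = "\<lambda>l. j ! inv_into {..<m} f l"
    show "of_bool (ascent_pattern D (m - 1) ?i) * c j * (\<Prod>l<m. X l $ ?i l)
      = (if f \<in> stabilizer m j
        then of_bool (ascent_pattern D (m - 1) ((!) j)) * c j * (\<Prod>l<m. X l $ (j ! l)) else 0)"
    proof (cases "f \<in> stabilizer m j")
      case True
      then have eq: "?i l = j ! l" if "l < m" for l using that by (simp add: stabilizer_def)
      have "ascent_pattern D (m - 1) ?i = ascent_pattern D (m - 1) ((!) j)"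
        unfolding ascent_pattern_def using eq by simp
      moreover have "(\<Prod>l<m. X l $ ?i l) = (\<Prod>l<m. X l $ (j ! l))"
        using eq by (intro prod.cong) auto
      ultimately show ?thesis using True by simp
    next
      case False
      then have "\<not> ascent_pattern D (m - 1) ?i"
        using sorted_rearrangement_eq[OF j inv_into_bijection(2)[OF f]] f
        by (auto simp: stabilizer_def)
      with False show ?thesis by simp
    qed
  qed
  also have "\<dots> = (\<Sum>f\<in>stabilizer m j.
      of_bool (ascent_pattern D (m - 1) ((!) j)) * c j * (\<Prod>l<m. X l $ (j ! l)))"
    using finite_bijections by (subst sum.inter_filter[symmetric])
      (auto simp: stabilizer_def intro!: arg_cong2[where f = sum])
  finally show ?thesis by simp
qed

context unit_ball
begin

lemma zero_mem: "0\<^sub>v n \<in> U"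
  using average[of 0 "\<lambda>_. undefined"] by (simp add: zero_vec_def)

lemma bdd_above_polynomial:
  assumes "represents n m c P"
  shows "bdd_above ((\<lambda>x. cmod (P x)) ` U)"
proof -
  obtain R where R: "\<And>x k. x \<in> U \<Longrightarrow> k < n \<Longrightarrow> cmod (x $ k) \<le> R" using bounded by blast
  have "cmod (P x) \<le> (\<Sum>j\<in>monotone_indices n m. cmod (c j) * R ^ m)" if x: "x \<in> U" for x
  proof -
    have "P x = (\<Sum>j\<in>monotone_indices n m. c j * (\<Prod>k<m. x $ (j ! k)))"
      using assms x carrier by (auto simp: represents_def)
    also have "cmod \<dots> \<le> (\<Sum>j\<in>monotone_indices n m. cmod (c j) * R ^ m)"
    proof (rule sum_norm_le)
      fix j assume j: "j \<in> monotone_indices n m"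
      have "(\<Prod>k<m. cmod (x $ (j ! k))) \<le> (\<Prod>k<m. R)"
        using R[OF x] monotone_indices_nth_less[OF j] by (intro prod_mono) auto
      then show "cmod (c j * (\<Prod>k<m. x $ (j ! k))) \<le> cmod (c j) * R ^ m"
        by (simp add: norm_mult prod_norm[symmetric] mult_left_mono)
    qed
    finally show ?thesis .
  qed
  then show ?thesis by (intro bdd_aboveI2)
qed

text \<open>
  Induction on the number \<open>r\<close> of conditions. Each condition relates two neighbouring indices, by \<open><\<close>
  (cost \<open>\<kappa>\<close>) or by \<open>=\<close> (cost 1, the block-diagonal multiplier with singleton blocks).
\<close>

lemma pattern_truncation:
  fixes e :: "'i \<Rightarrow> nat \<Rightarrow> nat"
  assumes \<kappa>: "multiplier_bound U n (<) \<kappa>" "\<kappa> \<ge> 1" and I: "finite I"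
    and e: "\<And>i l. i \<in> I \<Longrightarrow> l < m \<Longrightarrow> e i l < n"
    and C: "\<And>X. (\<And>l. l < m \<Longrightarrow> X l \<in> U) \<Longrightarrow> cmod (\<Sum>i\<in>I. s i * (\<Prod>l<m. X l $ e i l)) \<le> C"
    and X: "\<And>l. l < m \<Longrightarrow> X l \<in> U" and r: "r \<le> m - 1"
  shows "cmod (\<Sum>i\<in>I. of_bool (ascent_pattern D r (e i)) * s i * (\<Prod>l<m. X l $ e i l)) \<le> \<kappa> ^ r * C"
  using r X
proof (induction r arbitrary: X)
  case 0
  have "ascent_pattern D 0 i" for i by (simp add: ascent_pattern_def)
  then show ?case using C[OF "0.prems"(2)] by simp
next
  case (Suc r)
  define R :: "nat \<Rightarrow> nat \<Rightarrow> bool" where "R = (if r \<in> D then (<) else (=))"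
  define \<kappa>' where "\<kappa>' = (if r \<in> D then \<kappa> else 1)"
  have "0 \<le> cmod (\<Sum>i\<in>I. s i * (\<Prod>l<m. X l $ e i l))" by simp
  also have "\<dots> \<le> C" using Suc.prems(2) by (intro C)
  finally have "C \<ge> 0" .
  have R: "multiplier_bound U n R \<kappa>'"
    using \<kappa>(1) multiplier_bound_blocks[of "\<lambda>a. a" "\<lambda>_. True" "\<lambda>_. True"]
    unfolding R_def \<kappa>'_def by (auto elim: multiplier_bound_cong)
  have weight: "of_bool (R (e i r) (e i (Suc r))) * (of_bool (ascent_pattern D r (e i)) * s i)
      = of_bool (ascent_pattern D (Suc r) (e i)) * s i" for i
    by (auto simp: ascent_pattern_Suc R_def)
  have "cmod (\<Sum>i\<in>I. of_bool (R (e i r) (e i (Suc r))) * (of_bool (ascent_pattern D r (e i)) * s i)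
      * (\<Prod>l<m. X l $ e i l)) \<le> \<kappa>' * (\<kappa> ^ r * C)"
    using Suc.prems by (intro multiplier_bound_multilinear[OF R I e] Suc.IH) auto
  also have "\<dots> \<le> \<kappa> ^ Suc r * C"
    using \<kappa>(2) \<open>C \<ge> 0\<close> mult_right_mono[of \<kappa>' \<kappa> "\<kappa> ^ r * C"]
    by (auto simp: \<kappa>'_def mult.assoc)
  finally show ?case unfolding weight .
qed

text \<open>
  The part of the symmetrized form with pattern \<open>D\<close> is the part of \<open>L\<^sub>P\<close> with pattern \<open>D\<close> times the
  common order of the stabilizers, which is at least 1. So the bound for the former passes to the
  latter.
\<close>

lemma pattern_part_bound:
  assumes \<kappa>: "multiplier_bound U n (<) \<kappa>" "\<kappa> \<ge> 1"
    and P: "represents n m c P" and B: "\<And>x. x \<in> U \<Longrightarrow> cmod (P x) \<le> B"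
    and X: "\<And>l. l < m \<Longrightarrow> X l \<in> U"
  shows "cmod (\<Sum>j\<in>monotone_indices n m.
      of_bool (ascent_pattern D (m - 1) ((!) j)) * c j * (\<Prod>k<m. X k $ (j ! k)))
    \<le> \<kappa> ^ (m - 1) * (real m ^ m * B)"
proof -
  let ?J = "monotone_indices n m"
  \<comment> \<open>The term of \<open>j\<close> and \<open>f\<close> evaluates argument \<open>f k\<close> at coordinate \<open>j ! k\<close>; listed by arguments
      instead of factors, its index is \<open>j\<close> composed with the inverse of \<open>f\<close>.\<close>
  let ?e = "\<lambda>(j, f) l. j ! inv_into {..<m} f l"
  let ?I = "?J \<times> bijections m"
  let ?L = "\<Sum>j\<in>?J. of_bool (ascent_pattern D (m - 1) ((!) j)) * c j * (\<Prod>k<m. X k $ (j ! k))"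
  let ?T = "\<Sum>i\<in>?I. of_bool (ascent_pattern D (m - 1) (?e i)) * c (fst i) * (\<Prod>l<m. X l $ ?e i l)"
  have fin: "finite ?I" by (simp add: finite_monotone_indices finite_bijections)
  have e: "?e i l < n" if il: "i \<in> ?I" "l < m" for i l
  proof -
    obtain j f where i: "i = (j, f)" "j \<in> ?J" "f \<in> bijections m" using il(1) by auto
    then have "inv_into {..<m} f l < m"
      using bij_betwE[OF inv_into_bijection(2)] il(2) by auto
    then show ?thesis using i by (simp add: monotone_indices_nth_less)
  qed
  have sym: "cmod (\<Sum>i\<in>?I. c (fst i) * (\<Prod>l<m. X l $ ?e i l)) \<le> real m ^ m * B"
    if X: "\<And>l. l < m \<Longrightarrow> X l \<in> U" for X
  proof -
    have "(\<Sum>i\<in>?I. c (fst i) * (\<Prod>l<m. X l $ ?e i l))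
        = (\<Sum>j\<in>?J. \<Sum>f\<in>bijections m. c j * (\<Prod>l<m. X l $ (j ! inv_into {..<m} f l)))"
      by (subst sum.cartesian_product) (simp add: case_prod_unfold)
    also have "\<dots> = (\<Sum>j\<in>?J. \<Sum>f\<in>bijections m. c j * (\<Prod>k<m. X (f k) $ (j ! k)))"
    proof (intro sum.cong refl arg_cong2[where f = "(*)"])
      fix j f assume f: "f \<in> bijections m"
      have "(\<Prod>l<m. X l $ (j ! inv_into {..<m} f l))
          = (\<Prod>k<m. X (f k) $ (j ! inv_into {..<m} f (f k)))"
        by (rule prod.reindex_bij_betw[OF inv_into_bijection(1)[OF f], symmetric])
      also have "\<dots> = (\<Prod>k<m. X (f k) $ (j ! k))"
        using inv_into_bijection(1)[OF f] by (intro prod.cong) (auto simp: bij_betw_def)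
      finally show "(\<Prod>l<m. X l $ (j ! inv_into {..<m} f l)) = (\<Prod>k<m. X (f k) $ (j ! k))" .
    qed
    finally show ?thesis using polarization[OF P B X] by simp
  qed
  have T_le: "cmod ?T \<le> \<kappa> ^ (m - 1) * (real m ^ m * B)"
    by (rule pattern_truncation[OF \<kappa> fin e sym X]) auto
  have "?T = (\<Sum>j\<in>?J. \<Sum>f\<in>bijections m. of_bool (ascent_pattern D (m - 1) (\<lambda>l. j ! inv_into {..<m} f l))
        * c j * (\<Prod>l<m. X l $ (j ! inv_into {..<m} f l)))"
    by (subst sum.cartesian_product) (simp add: case_prod_unfold)
  also have "\<dots> = (\<Sum>j\<in>?J. of_nat (card (stabilizer m j)) *
        (of_bool (ascent_pattern D (m - 1) ((!) j)) * c j * (\<Prod>l<m. X l $ (j ! l))))"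
    by (intro sum.cong refl sum_pattern_symmetrized)
  finally have T: "?T = (\<Sum>j\<in>?J. of_nat (card (stabilizer m j)) *
        (of_bool (ascent_pattern D (m - 1) ((!) j)) * c j * (\<Prod>l<m. X l $ (j ! l))))" .
  have "cmod ?L \<le> cmod ?T"
  proof (cases "\<exists>j\<in>?J. ascent_pattern D (m - 1) ((!) j)")
    case False
    then have "?L = 0" by (intro sum.neutral) auto
    then show ?thesis by simp
  next
    case True
    then obtain j0 where j0: "j0 \<in> ?J" "ascent_pattern D (m - 1) ((!) j0)" by blast
    let ?w = "card (stabilizer m j0)"
    have "?T = of_nat ?w * ?L"
      unfolding T sum_distrib_left
    proof (intro sum.cong refl)
      fix j
      show "of_nat (card (stabilizer m j)) *
          (of_bool (ascent_pattern D (m - 1) ((!) j)) * c j * (\<Prod>l<m. X l $ (j ! l)))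
        = of_nat ?w * (of_bool (ascent_pattern D (m - 1) ((!) j)) * c j * (\<Prod>l<m. X l $ (j ! l)))"
        using stabilizer_cong_pattern[OF _ j0(2), of j] by (cases "ascent_pattern D (m - 1) ((!) j)") auto
    qed
    then have "cmod ?T = real ?w * cmod ?L" by (simp add: norm_mult)
    moreover have "1 * cmod ?L \<le> real ?w * cmod ?L"
      using card_stabilizer_pos[of m j0] by (intro mult_right_mono) auto
    ultimately show ?thesis by simp
  qed
  with T_le show ?thesis by linarith
qed

text \<open>
  Every monotone index has exactly one of the \<open>2\<^bsup>m-1\<^esup>\<close> patterns, so \<open>L\<^sub>P\<close> is the sum of its pattern
  parts.
\<close>

theorem sup_associated_form_le:
  assumes \<kappa>: "multiplier_bound U n (<) \<kappa>" "\<kappa> \<ge> 1" and K: "4 * \<kappa> \<le> K"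
    and P: "homogeneous_polynomial n m P"
  shows "(SUP X \<in> {X. \<forall>k<m. X k \<in> U}. cmod (associated_form n m P X))
    \<le> K ^ (m\<^sup>2) * (SUP x \<in> U. cmod (P x))"
proof (rule cSUP_least)
  show "{X. \<forall>k<m. X k \<in> U} \<noteq> {}" using zero_mem by auto
next
  fix X assume "X \<in> {X. \<forall>k<m. X k \<in> U}"
  then have X: "X k \<in> U" if "k < m" for k using that by simp
  let ?J = "monotone_indices n m"
  define c where "c = coefficients n m P"
  have c: "represents n m c P" using P unfolding c_def by (rule represents_coefficients)
  define B where "B = (SUP x \<in> U. cmod (P x))"
  have B: "cmod (P x) \<le> B" if "x \<in> U" for x
    unfolding B_def using that bdd_above_polynomial[OF c] by (rule cSUP_upper)
  have B0: "B \<ge> 0" using B[OF zero_mem] norm_ge_zero order_trans by blast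
  let ?L = "\<lambda>D. \<Sum>j\<in>?J. of_bool (ascent_pattern D (m - 1) ((!) j)) * c j * (\<Prod>k<m. X k $ (j ! k))"
  have one: "(\<Sum>D\<in>Pow {..<m - 1}. of_bool (ascent_pattern D (m - 1) ((!) j))) = (1 :: complex)"
    if j: "j \<in> ?J" for j
  proof -
    let ?D = "{k. k < m - 1 \<and> j ! k < j ! Suc k}"
    have "(\<Sum>D\<in>Pow {..<m - 1}. of_bool (ascent_pattern D (m - 1) ((!) j)))
        = (\<Sum>D\<in>Pow {..<m - 1}. if D = ?D then 1 else (0 :: complex))"
      using ascents_unique_pattern[OF j] by (intro sum.cong refl) auto
    also have "\<dots> = 1" by (subst sum.delta) auto
    finally show ?thesis .
  qed
  have "associated_form n m P X
      = (\<Sum>j\<in>?J. (\<Sum>D\<in>Pow {..<m - 1}. of_bool (ascent_pattern D (m - 1) ((!) j))) * (c j * (\<Prod>k<m. X k $ (j ! k))))"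
    unfolding associated_form_def c_def[symmetric] by (intro sum.cong refl) (simp only: one mult_1)
  also have "\<dots> = (\<Sum>j\<in>?J. \<Sum>D\<in>Pow {..<m - 1}.
      of_bool (ascent_pattern D (m - 1) ((!) j)) * c j * (\<Prod>k<m. X k $ (j ! k)))"
    by (simp only: sum_distrib_right mult.assoc)
  also have "\<dots> = (\<Sum>D\<in>Pow {..<m - 1}. ?L D)" by (rule sum.swap)
  also have "cmod \<dots> \<le> (\<Sum>D\<in>Pow {..<m - 1}. \<kappa> ^ (m - 1) * (real m ^ m * B))"
    by (intro sum_norm_le pattern_part_bound[OF \<kappa> c B X])
  also have "\<dots> = 2 ^ (m - 1) * (\<kappa> ^ (m - 1) * (real m ^ m * B))"
    by (simp add: card_Pow)
  also have "\<dots> \<le> (4 * \<kappa>) ^ (m\<^sup>2) * B"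
  proof (cases "m = 0")
    case True
    then show ?thesis by simp
  next
    case False
    have "real m \<le> 2 ^ m" using of_nat_less_two_power[of m] by (simp add: less_imp_le)
    then have "real m ^ m \<le> (2 ^ m) ^ m" by (intro power_mono) auto
    also have "\<dots> = 2 ^ (m\<^sup>2)" by (simp add: power_mult[symmetric] power2_eq_square)
    finally have mm: "real m ^ m \<le> 2 ^ (m\<^sup>2)" .
    have "m - 1 \<le> m\<^sup>2" by (metis diff_le_self le_square le_trans power2_eq_square)
    then have "(2 * \<kappa>) ^ (m - 1) \<le> (2 * \<kappa>) ^ (m\<^sup>2)"
      using \<kappa>(2) by (intro power_increasing) auto
    then have "(2 * \<kappa>) ^ (m - 1) * real m ^ m \<le> (2 * \<kappa>) ^ (m\<^sup>2) * 2 ^ (m\<^sup>2)"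
      using mm \<kappa>(2) by (intro mult_mono) auto
    also have "\<dots> = (4 * \<kappa>) ^ (m\<^sup>2)" unfolding power_mult_distrib[symmetric] by simp
    finally have "(2 * \<kappa>) ^ (m - 1) * real m ^ m * B \<le> (4 * \<kappa>) ^ (m\<^sup>2) * B"
      using B0 by (rule mult_right_mono)
    then show ?thesis by (simp add: power_mult_distrib mult_ac)
  qed
  also have "\<dots> \<le> K ^ (m\<^sup>2) * B"
    using \<kappa>(2) K B0 by (intro mult_right_mono power_mono) auto
  finally show "cmod (associated_form n m P X) \<le> K ^ (m\<^sup>2) * (SUP x \<in> U. cmod (P x))"
    unfolding B_def .
qed

end

section \<open>Unit balls of 1-unconditional norms\<close>

text \<open>
  Boundedness of the coordinates uses unconditionality: \<open>|x\<^sub>k| N(e\<^sub>k) \<le> N(x)\<close>.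
\<close>

lemma unit_ball_norm:
  assumes N: "is_norm n N" and unc: "one_unconditional n N"
  shows "unit_ball n {x. x \<in> carrier_vec n \<and> N x \<le> 1}" (is "unit_ball n ?U")
proof
  have scale: "N (a \<cdot>\<^sub>v x) = cmod a * N x" if "x \<in> carrier_vec n" for a x
    using N that by (simp add: is_norm_def)
  have mono: "N x \<le> N y" if "x \<in> carrier_vec n" "y \<in> carrier_vec n" "\<And>k. k < n \<Longrightarrow> cmod (x $ k) \<le> cmod (y $ k)" for x y
    using unc that by (simp add: one_unconditional_def)
  show "?U \<subseteq> carrier_vec n" by auto
  show "x \<in> ?U" if "y \<in> ?U" "x \<in> carrier_vec n" "\<And>k. k < n \<Longrightarrow> cmod (x $ k) \<le> cmod (y $ k)" for x y
    using mono[of x y] that by simp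
  show "vec n (\<lambda>a. (\<Sum>l<m. X l $ a) / of_nat m) \<in> ?U" if X: "\<And>l. l < m \<Longrightarrow> X l \<in> ?U" for m X
  proof -
    let ?s = "\<lambda>m. vec n (\<lambda>a. \<Sum>l<m. X l $ a)"
    have "N (?s k) \<le> real k" if "k \<le> m" for k
      using that
    proof (induction k)
      case 0
      have "?s 0 = 0\<^sub>v n" by (intro eq_vecI) auto
      moreover have "N (0\<^sub>v n) = 0" using N by (simp add: is_norm_def)
      ultimately show ?case by simp
    next
      case (Suc k)
      have Xk: "X k \<in> carrier_vec n" "N (X k) \<le> 1" using X[of k] Suc.prems by auto
      have "?s (Suc k) = ?s k + X k" using Xk by (intro eq_vecI) auto
      then have "N (?s (Suc k)) \<le> N (?s k) + N (X k)" using N Xk by (simp add: is_norm_def)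
      then show ?case using Suc Xk by simp
    qed
    then have s: "N (?s m) \<le> real m" by simp
    have "vec n (\<lambda>a. (\<Sum>l<m. X l $ a) / of_nat m) = (1 / of_nat m) \<cdot>\<^sub>v ?s m"
      by (intro eq_vecI) auto
    then have "N (vec n (\<lambda>a. (\<Sum>l<m. X l $ a) / of_nat m)) = N (?s m) / real m"
      by (simp add: scale norm_divide)
    also have "\<dots> \<le> 1" using s by (cases "m = 0") auto
    finally show ?thesis by simp
  qed
  show "\<exists>R. \<forall>x\<in>?U. \<forall>k<n. cmod (x $ k) \<le> R"
  proof (intro exI ballI allI impI)
    fix x k assume x: "x \<in> ?U" and k: "k < n"
    let ?e = "\<lambda>k. unit_vec n k :: complex vec"
    have pos: "N (?e k) > 0" if "k < n" for k
    proof -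
      have "?e k $ k \<noteq> 0\<^sub>v n $ k" using that by simp
      then have "?e k \<noteq> 0\<^sub>v n" by metis
      then show ?thesis using N by (simp add: is_norm_def order_less_le eq_commute[of 0])
    qed
    have "cmod (x $ k) * N (?e k) = N (x $ k \<cdot>\<^sub>v ?e k)" by (simp add: scale)
    also have "\<dots> \<le> N x" using x k by (intro mono) (auto simp: unit_vec_def)
    also have "\<dots> \<le> 1" using x by simp
    finally have "cmod (x $ k) \<le> 1 / N (?e k)" using pos[OF k] by (simp add: field_simps)
    also have "\<dots> \<le> (\<Sum>k<n. 1 / N (?e k))"
      using k pos by (intro member_le_sum) (auto simp: less_imp_le)
    finally show "cmod (x $ k) \<le> (\<Sum>k<n. 1 / N (?e k))" .
  qed
qed

section \<open>Triangular truncation on \<open>\<ell>\<^sub>p\<close>\<close>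

text \<open>
  The power mean inequality, obtained by summing the tangent line inequality for \<open>t\<^sup>p\<close> at the
  arithmetic mean \<open>A\<close>.
\<close>

lemma powr_sum_le:
  fixes t :: "'a \<Rightarrow> real"
  assumes p: "p \<ge> 1" and fin: "finite S" and t: "\<And>i. i \<in> S \<Longrightarrow> 0 \<le> t i"
  shows "(\<Sum>i\<in>S. t i) powr p \<le> real (card S) powr (p - 1) * (\<Sum>i\<in>S. t i powr p)"
proof (cases "(\<Sum>i\<in>S. t i) = 0")
  case True
  then show ?thesis by (simp add: sum_nonneg)
next
  case False
  have S: "S \<noteq> {}" using False by auto
  define A where "A = (\<Sum>i\<in>S. t i) / card S"
  have c: "real (card S) > 0" using S fin by (simp add: card_gt_0_iff)
  have "(\<Sum>i\<in>S. t i) \<ge> 0" using t by (rule sum_nonneg)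
  then have A: "A > 0" unfolding A_def using False c by (intro divide_pos_pos) linarith+
  have tangent: "A powr p + p * A powr (p - 1) * (t i - A) \<le> t i powr p" if i: "i \<in> S" for i
  proof -
    \<comment> \<open>Young's inequality for \<open>t\<close> and \<open>A\<^bsup>p-1\<^esup>\<close>.\<close>
    have "t i * A powr (p - 1) \<le> (1/p) * t i powr p + (1 - 1/p) * A powr p"
    proof (cases "p = 1 \<or> t i = 0")
      case True then show ?thesis using t[OF i] A p by auto
    next
      case False
      then have p1: "p > 1" "t i > 0" using p t[OF i] by auto
      have "(t i powr p) powr (1/p) * (A powr p) powr (1 - 1/p) \<le> (1/p) * (t i powr p) + (1 - 1/p) * A powr p"
        by (rule Youngs_inequality_0) (use p1 A in auto)
      moreover have "p * (1 - 1/p) = p - 1" using p1 by (simp add: field_simps)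
      ultimately show ?thesis using t[OF i] A p1 by (simp add: powr_powr)
    qed
    then have "p * (t i * A powr (p - 1)) \<le> p * ((1/p) * t i powr p + (1 - 1/p) * A powr p)"
      using p by (intro mult_left_mono) auto
    also have "\<dots> = t i powr p + (p - 1) * A powr p" using p by (simp add: field_simps)
    moreover have "A powr p = A powr (p - 1) * A" using A
      by (simp add: powr_diff)
    ultimately show ?thesis by (simp add: algebra_simps)
  qed
  have "real (card S) * A powr p
      = (\<Sum>i\<in>S. A powr p + p * A powr (p - 1) * (t i - A))"
    using c by (simp add: sum.distrib sum_subtractf flip: sum_distrib_left) (simp add: A_def)
  also have "\<dots> \<le> (\<Sum>i\<in>S. t i powr p)"
    by (intro sum_mono tangent)
  finally have *: "real (card S) * A powr p \<le> (\<Sum>i\<in>S. t i powr p)" .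
  have "(\<Sum>i\<in>S. t i) powr p = (card S * A) powr p" using c by (simp add: A_def)
  also have "\<dots> = card S powr (p - 1) * (card S * A powr p)"
    using c A by (simp add: powr_mult powr_diff)
  also have "\<dots> \<le> card S powr (p - 1) * (\<Sum>i\<in>S. t i powr p)"
    using * by (intro mult_left_mono) auto
  finally show ?thesis .
qed

lemma powr_inverse_le_one_iff:
  assumes "0 < p" "0 \<le> (s :: real)"
  shows "s powr (1 / p) \<le> 1 \<longleftrightarrow> s \<le> 1"
proof
  assume "s powr (1 / p) \<le> 1"
  then have "(s powr (1 / p)) powr p \<le> 1 powr p" using assms by (intro powr_mono2) auto
  then show "s \<le> 1" using assms by (simp add: powr_powr)
next
  assume "s \<le> 1"
  then show "s powr (1 / p) \<le> 1" using assms by (intro powr_le1) auto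
qed

lemma lp_ball_iff:
  assumes "p > 0"
  shows "x \<in> carrier_vec n \<and> lp_norm p x \<le> 1
    \<longleftrightarrow> x \<in> carrier_vec n \<and> (\<Sum>k<n. cmod (x $ k) powr p) \<le> 1"
  using assms by (auto simp: lp_norm_def powr_inverse_le_one_iff sum_nonneg)

lemma unit_ball_lp:
  assumes p: "p \<ge> 1"
  shows "unit_ball n {x. x \<in> carrier_vec n \<and> lp_norm p x \<le> 1}"
proof -
  let ?U = "{x. x \<in> carrier_vec n \<and> (\<Sum>k<n. cmod (x $ k) powr p) \<le> 1}"
  have "unit_ball n ?U"
  proof
    show "?U \<subseteq> carrier_vec n" by auto
    show "x \<in> ?U" if y: "y \<in> ?U" and x: "x \<in> carrier_vec n" "\<And>k. k < n \<Longrightarrow> cmod (x $ k) \<le> cmod (y $ k)" for x y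
    proof -
      have "(\<Sum>k<n. cmod (x $ k) powr p) \<le> (\<Sum>k<n. cmod (y $ k) powr p)"
        using x p by (intro sum_mono powr_mono2) auto
      then show ?thesis using x y by simp
    qed
    show "vec n (\<lambda>a. (\<Sum>l<m. X l $ a) / of_nat m) \<in> ?U" if X: "\<And>l. l < m \<Longrightarrow> X l \<in> ?U" for m X
    proof (cases "m = 0")
      case True
      then show ?thesis using p by simp
    next
      case False
      have "(\<Sum>k<n. cmod ((\<Sum>l<m. X l $ k) / of_nat m) powr p)
          \<le> (\<Sum>k<n. (\<Sum>l<m. cmod (X l $ k) powr p) / m)"
      proof (rule sum_mono)
        fix k
        have "cmod ((\<Sum>l<m. X l $ k) / of_nat m) powr p \<le> ((\<Sum>l<m. cmod (X l $ k)) / m) powr p"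
          using p by (intro powr_mono2) (auto simp: norm_divide intro!: divide_right_mono norm_sum)
        also have "\<dots> = (\<Sum>l<m. cmod (X l $ k)) powr p / m powr p"
          by (simp add: powr_divide sum_nonneg)
        also have "\<dots> \<le> (real m powr (p - 1) * (\<Sum>l<m. cmod (X l $ k) powr p)) / m powr p"
          using powr_sum_le[OF p, of "{..<m}" "\<lambda>l. cmod (X l $ k)"] by (intro divide_right_mono) auto
        also have "\<dots> = (\<Sum>l<m. cmod (X l $ k) powr p) / m"
          using False by (simp add: powr_diff)
        finally show "cmod ((\<Sum>l<m. X l $ k) / of_nat m) powr p \<le> (\<Sum>l<m. cmod (X l $ k) powr p) / m" .
      qed
      also have "\<dots> = (\<Sum>l<m. \<Sum>k<n. cmod (X l $ k) powr p) / m"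
        by (subst sum.swap) (simp add: sum_divide_distrib)
      also have "\<dots> \<le> (\<Sum>l<m. 1) / m"
        using X by (intro divide_right_mono sum_mono) auto
      also have "\<dots> = 1" using False by simp
      finally show ?thesis by simp
    qed
    show "\<exists>R. \<forall>x\<in>?U. \<forall>k<n. cmod (x $ k) \<le> R"
    proof (intro exI ballI allI impI)
      fix x k assume x: "x \<in> ?U" and k: "k < n"
      have "cmod (x $ k) powr p \<le> (\<Sum>k<n. cmod (x $ k) powr p)"
        using k by (intro member_le_sum) auto
      then have "(cmod (x $ k) powr p) powr (1 / p) \<le> 1"
        using x p by (subst powr_inverse_le_one_iff) auto
      then show "cmod (x $ k) \<le> 1" using p by (simp add: powr_powr)
    qed
  qed
  then show ?thesis using p by (simp add: lp_ball_iff)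
qed

lemma powr_inverse_add_le:
  fixes a b :: real
  assumes p: "1 \<le> p" and "0 \<le> a" "0 \<le> b"
  shows "a powr (1 / p) + b powr (1 / p) \<le> 2 powr (1 - 1 / p) * (a + b) powr (1 / p)"
proof -
  let ?t = "\<lambda>i::bool. if i then a powr (1 / p) else b powr (1 / p)"
  have "(a powr (1 / p) + b powr (1 / p)) powr p \<le> 2 powr (p - 1) * (a + b)"
    using powr_sum_le[OF p, of UNIV ?t] assms by (simp add: UNIV_bool powr_powr add.commute)
  then have "((a powr (1 / p) + b powr (1 / p)) powr p) powr (1 / p) \<le> (2 powr (p - 1) * (a + b)) powr (1 / p)"
    using p by (intro powr_mono2) auto
  also have "\<dots> = 2 powr (1 - 1 / p) * (a + b) powr (1 / p)"
    using assms by (simp add: powr_mult powr_powr diff_divide_distrib)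
  finally show ?thesis using p by (simp add: powr_powr)
qed

lemma sum_split_at:
  fixes f :: "nat \<Rightarrow> 'a :: comm_monoid_add"
  assumes "u \<le> c" "c < v"
  shows "sum f {u..<v} = sum f {u..<c} + (f c + sum f {Suc c..<v})"
  using assms sum.atLeastLessThan_concat[of u c v f] by (simp add: sum.atLeast_Suc_lessThan)

text \<open>
  An atom of \<open>f\<close> may carry more than half of the mass, so the median \<open>c\<close> itself is left out of both
  halves.
\<close>

lemma median_index:
  fixes f :: "nat \<Rightarrow> real"
  assumes f: "\<And>a. 0 \<le> f a" and uv: "u < v"
  obtains c where "u \<le> c" "c < v" "2 * sum f {u..<c} \<le> sum f {u..<v}" "2 * sum f {Suc c..<v} \<le> sum f {u..<v}"
proof -
  define Q where "Q c \<longleftrightarrow> u \<le> c \<and> sum f {u..<v} \<le> 2 * sum f {u..<Suc c}" for c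
  define c where "c = (LEAST c. Q c)"
  have "Q (v - 1)" using uv f sum_nonneg[of "{u..<v}" f] by (simp add: Q_def)
  then have c: "Q c" "c \<le> v - 1" unfolding c_def by (auto intro: LeastI Least_le)
  have uc: "u \<le> c" "c < v" using c uv by (auto simp: Q_def)
  have low: "2 * sum f {u..<c} \<le> sum f {u..<v}"
  proof (cases "c = u")
    case True
    then show ?thesis using f by (simp add: sum_nonneg)
  next
    case False
    then have "\<not> Q (c - 1)" using uc unfolding c_def by (intro not_less_Least) linarith
    moreover have "u \<le> c - 1" "Suc (c - 1) = c" using False uc by auto
    ultimately show ?thesis by (simp add: Q_def)
  qed
  have "2 * sum f {Suc c..<v} \<le> sum f {u..<v}"
    using c(1) uc by (simp add: Q_def sum_split_at)
  with that uc low show ?thesis by blast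
qed

text \<open>
  The fixed point of \<open>K = 2\<^bsup>1-2/p\<^esup> K + 2\<close>, the recursion for the cost of a truncation. It is positive
  and finite because \<open>p < 2\<close>.
\<close>

definition truncation_constant :: "real \<Rightarrow> real" where
  "truncation_constant p = 2 / (1 - 2 powr (1 - 2 / p))"

lemma truncation_constant:
  assumes "1 \<le> p" "p < 2"
  shows "truncation_constant p \<ge> 2"
    and "truncation_constant p * 2 powr (1 - 2 / p) + 2 = truncation_constant p"
proof -
  have "1 - 2 / p < 0" using assms by (simp add: field_simps)
  then have lt: "2 powr (1 - 2 / p) < (1 :: real)" using powr_less_mono[of "1 - 2 / p" 0 2] by simp
  moreover have "0 < 2 powr (1 - 2 / p)" by simp
  ultimately show "truncation_constant p \<ge> 2"
    unfolding truncation_constant_def by (simp add: field_simps del: powr_gt_zero)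
  have geometric: "2 / (1 - t) * t + 2 = 2 / (1 - t)" if "t < 1" for t :: real
    using that by (simp add: field_simps)
  show "truncation_constant p * 2 powr (1 - 2 / p) + 2 = truncation_constant p"
    unfolding truncation_constant_def using geometric[OF lt] .
qed

text \<open>
  Cutting at \<open>c\<close> leaves the triangles to the left and to the right of \<open>c\<close>, the rectangle of pairs
  \<open>a < c \<le> b\<close>, and the remainder of the row \<open>a = c\<close>.
\<close>

lemma triangular_sum_split:
  fixes g :: "nat \<Rightarrow> nat \<Rightarrow> 'a :: comm_ring_1"
  assumes "u \<le> c" "c < v"
  shows "(\<Sum>a=u..<v. \<Sum>b=u..<v. of_bool (a < b) * g a b)
    = (\<Sum>a=u..<c. \<Sum>b=u..<c. of_bool (a < b) * g a b) + (\<Sum>a=u..<c. \<Sum>b=c..<v. g a b)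
    + (\<Sum>b=Suc c..<v. g c b) + (\<Sum>a=Suc c..<v. \<Sum>b=Suc c..<v. of_bool (a < b) * g a b)"
proof -
  let ?G = "\<lambda>a b. of_bool (a < b) * g a b"
  have row: "(\<Sum>b=u..<v. ?G a b) = (\<Sum>b=u..<k. ?G a b) + (\<Sum>b=k..<v. ?G a b)" if "u \<le> k" "k \<le> v" for a k
    by (rule sum.atLeastLessThan_concat[OF that, symmetric])
  have "(\<Sum>a=u..<v. \<Sum>b=u..<v. ?G a b)
      = (\<Sum>a=u..<c. \<Sum>b=u..<v. ?G a b) + ((\<Sum>b=u..<v. ?G c b) + (\<Sum>a=Suc c..<v. \<Sum>b=u..<v. ?G a b))"
    by (rule sum_split_at[OF assms])
  also have "(\<Sum>a=u..<c. \<Sum>b=u..<v. ?G a b) = (\<Sum>a=u..<c. (\<Sum>b=u..<c. ?G a b) + (\<Sum>b=c..<v. g a b))"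
    using assms by (intro sum.cong refl) (subst row[of c], auto intro!: sum.cong)
  also have "(\<Sum>b=u..<v. ?G c b) = (\<Sum>b=Suc c..<v. g c b)"
  proof -
    have "(\<Sum>b=u..<Suc c. ?G c b) = 0" by (intro sum.neutral) auto
    moreover have "(\<Sum>b=Suc c..<v. ?G c b) = (\<Sum>b=Suc c..<v. g c b)" by (intro sum.cong) auto
    ultimately show ?thesis using row[of "Suc c" c] assms by simp
  qed
  also have "(\<Sum>a=Suc c..<v. \<Sum>b=u..<v. ?G a b) = (\<Sum>a=Suc c..<v. \<Sum>b=Suc c..<v. ?G a b)"
  proof (rule sum.cong[OF refl])
    fix a assume a: "a \<in> {Suc c..<v}"
    have "(\<Sum>b=u..<Suc c. ?G a b) = 0" using a by (intro sum.neutral) auto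
    then show "(\<Sum>b=u..<v. ?G a b) = (\<Sum>b=Suc c..<v. ?G a b)" using row[of "Suc c" a] assms by simp
  qed
  finally show ?thesis by (simp add: sum.distrib add_ac)
qed

text \<open>
  The Christ-Kiselev argument. Cut at a median \<open>c\<close> of \<open>f\<close>. The rectangle and the row cost \<open>2 C\<close>. In
  the triangles each half of \<open>f\<close> contributes a factor \<open>2\<^bsup>-1/p\<^esup>\<close>, and the two halves of \<open>h\<close> together
  contribute \<open>2\<^bsup>1-1/p\<^esup>\<close> by concavity of \<open>t\<^bsup>1/p\<^esup>\<close>. So by induction they cost \<open>2\<^bsup>1-2/p\<^esup> K\<close>.
\<close>

lemma triangular_sum_le:
  fixes g :: "nat \<Rightarrow> nat \<Rightarrow> complex" and f h :: "nat \<Rightarrow> real"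
  assumes p: "1 \<le> p" "p < 2" and f: "\<And>a. 0 \<le> f a" and h: "\<And>b. 0 \<le> h b" and C: "0 \<le> C"
    and rect: "\<And>A B. A \<subseteq> {u..<v} \<Longrightarrow> B \<subseteq> {u..<v} \<Longrightarrow>
      cmod (\<Sum>a\<in>A. \<Sum>b\<in>B. g a b) \<le> C * (sum f A powr (1 / p) * sum h B powr (1 / p))"
  shows "cmod (\<Sum>a=u..<v. \<Sum>b=u..<v. of_bool (a < b) * g a b)
    \<le> truncation_constant p * (C * (sum f {u..<v} powr (1 / p) * sum h {u..<v} powr (1 / p)))"
  using rect
proof (induction "v - u" arbitrary: u v rule: less_induct)
  case less
  let ?K = "truncation_constant p"
  let ?T = "\<lambda>u v. \<Sum>a=u..<v. \<Sum>b=u..<v. of_bool (a < b) * g a b"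
  let ?F = "\<lambda>u v. sum f {u..<v}" and ?H = "\<lambda>u v. sum h {u..<v}"
  let ?q = "1 / p"
  have K: "?K \<ge> 2" "?K * 2 powr (1 - 2 / p) + 2 = ?K" using truncation_constant[OF p] by auto
  have q: "?q \<ge> 0" using p by simp
  show ?case
  proof (cases "u < v")
    case False
    then show ?thesis by simp
  next
    case True
    from median_index[of f, OF f True] obtain c where c: "u \<le> c" "c < v"
      and med: "2 * ?F u c \<le> ?F u v" "2 * ?F (Suc c) v \<le> ?F u v" by metis
    have mono: "sum f A powr ?q \<le> ?F u v powr ?q" "sum h A powr ?q \<le> ?H u v powr ?q"
      if "A \<subseteq> {u..<v}" for A
      using that f h q by (intro powr_mono2 sum_mono2 sum_nonneg; simp)+
    have piece: "cmod (\<Sum>a\<in>A. \<Sum>b\<in>B. g a b) \<le> C * (?F u v powr ?q * ?H u v powr ?q)"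
      if "A \<subseteq> {u..<v}" "B \<subseteq> {u..<v}" for A B
      using less.prems[OF that] mono[OF that(1)] mono[OF that(2)] C
      by (meson mult_left_mono mult_mono order_trans powr_ge_zero)
    have half: "F' powr ?q \<le> 2 powr (- ?q) * ?F u v powr ?q" if "0 \<le> F'" "2 * F' \<le> ?F u v" for F'
    proof -
      have "F' powr ?q \<le> (?F u v / 2) powr ?q" using that q by (intro powr_mono2) auto
      also have "\<dots> = ?F u v powr ?q / 2 powr ?q"
        by (rule powr_divide)
      also have "\<dots> = 2 powr (- ?q) * ?F u v powr ?q" by (simp add: powr_minus_divide)
      finally show ?thesis .
    qed
    have diag: "cmod (?T u' v') \<le> ?K * C * 2 powr (- ?q) * ?F u v powr ?q * ?H u' v' powr ?q"
      if "v' - u' < v - u" "{u'..<v'} \<subseteq> {u..<v}" "2 * ?F u' v' \<le> ?F u v" for u' v'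
    proof -
      have "cmod (?T u' v') \<le> ?K * (C * (?F u' v' powr ?q * ?H u' v' powr ?q))"
        using that by (intro less.hyps less.prems) auto
      also have "\<dots> \<le> ?K * (C * ((2 powr (- ?q) * ?F u v powr ?q) * ?H u' v' powr ?q))"
        using K(1) C f that by (intro mult_left_mono mult_right_mono half) (auto simp: sum_nonneg)
      finally show ?thesis by (simp add: mult_ac)
    qed
    have "?H u c + ?H (Suc c) v \<le> ?H u v"
    proof -
      have "?H u v = ?H u c + (h c + ?H (Suc c) v)"
        by (rule sum_split_at[OF c])
      then show ?thesis using h[of c] by simp
    qed
    then have "(?H u c + ?H (Suc c) v) powr ?q \<le> ?H u v powr ?q"
      using q h by (intro powr_mono2) (auto intro: sum_nonneg add_nonneg_nonneg)
    then have H: "?H u c powr ?q + ?H (Suc c) v powr ?q \<le> 2 powr (1 - ?q) * ?H u v powr ?q"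
      using powr_inverse_add_le[OF p(1), of "?H u c" "?H (Suc c) v"] h
      by (smt (verit) mult_left_mono powr_ge_zero sum_nonneg)
    have left: "cmod (?T u c) \<le> ?K * C * 2 powr (- ?q) * ?F u v powr ?q * ?H u c powr ?q"
      by (rule diag[OF _ _ med(1)]) (use c in \<open>simp_all add: ivl_subset\<close>)
    have right: "cmod (?T (Suc c) v) \<le> ?K * C * 2 powr (- ?q) * ?F u v powr ?q * ?H (Suc c) v powr ?q"
      by (rule diag[OF _ _ med(2)]) (use c in \<open>simp_all add: ivl_subset\<close>)
    have top: "cmod (\<Sum>a\<in>{u..<c}. \<Sum>b\<in>{c..<v}. g a b) \<le> C * (?F u v powr ?q * ?H u v powr ?q)"
      by (rule piece) (use c in \<open>simp_all add: ivl_subset\<close>)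
    have middle: "cmod (\<Sum>a\<in>{c}. \<Sum>b\<in>{Suc c..<v}. g a b) \<le> C * (?F u v powr ?q * ?H u v powr ?q)"
      by (rule piece) (use c in \<open>simp_all add: ivl_subset\<close>)
    have split: "?T u v = ?T u c + (\<Sum>a\<in>{u..<c}. \<Sum>b\<in>{c..<v}. g a b)
        + (\<Sum>a\<in>{c}. \<Sum>b\<in>{Suc c..<v}. g a b) + ?T (Suc c) v"
      using triangular_sum_split[OF c, of g] by simp
    have "cmod (?T u v) \<le> cmod (?T u c) + cmod (\<Sum>a\<in>{u..<c}. \<Sum>b\<in>{c..<v}. g a b)
        + cmod (\<Sum>a\<in>{c}. \<Sum>b\<in>{Suc c..<v}. g a b) + cmod (?T (Suc c) v)"
      unfolding split by (intro norm_triangle_le add_mono order_refl)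
    also have "\<dots> \<le> ?K * C * 2 powr (- ?q) * ?F u v powr ?q * ?H u c powr ?q
        + C * (?F u v powr ?q * ?H u v powr ?q) + C * (?F u v powr ?q * ?H u v powr ?q)
        + ?K * C * 2 powr (- ?q) * ?F u v powr ?q * ?H (Suc c) v powr ?q"
      by (rule add_mono[OF add_mono[OF add_mono[OF left top] middle] right])
    also have "\<dots> = ?K * C * 2 powr (- ?q) * ?F u v powr ?q * (?H u c powr ?q + ?H (Suc c) v powr ?q)
        + 2 * (C * (?F u v powr ?q * ?H u v powr ?q))"
      by (simp add: algebra_simps)
    also have "\<dots> \<le> ?K * C * 2 powr (- ?q) * ?F u v powr ?q * (2 powr (1 - ?q) * ?H u v powr ?q)
        + 2 * (C * (?F u v powr ?q * ?H u v powr ?q))"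
      using K(1) C H by (intro add_right_mono mult_left_mono) auto
    also have "\<dots> = (?K * (2 powr (- ?q) * 2 powr (1 - ?q)) + 2) * (C * (?F u v powr ?q * ?H u v powr ?q))"
      by (simp add: algebra_simps)
    also have "\<dots> = ?K * (C * (?F u v powr ?q * ?H u v powr ?q))"
    proof -
      have "2 powr (- ?q) * 2 powr (1 - ?q) = (2 :: real) powr (1 - 2 / p)"
        by (simp flip: powr_add)
      then show ?thesis using K(2) by simp
    qed
    finally show ?thesis .
  qed
qed

text \<open>
  By homogeneity, the bound \<open>C\<close> on the unit ball bounds the sum over any rectangle \<open>A \<times> A'\<close> by
  \<open>C \<parallel>x|\<^sub>A\<parallel>\<^sub>p \<parallel>y|\<^bsub>A'\<^esub>\<parallel>\<^sub>p\<close>, which is the hypothesis of the recursion with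
  \<open>f = |x|\<^sup>p\<close> and \<open>h = |y|\<^sup>p\<close>.
\<close>

lemma multiplier_bound_less_lp:
  assumes p: "1 \<le> p" "p < 2"
  shows "multiplier_bound {x. x \<in> carrier_vec n \<and> lp_norm p x \<le> 1} n (<) (truncation_constant p)"
proof -
  define U where "U = {x. x \<in> carrier_vec n \<and> lp_norm p x \<le> 1}"
  have p0: "p > 0" using p by simp
  have U: "x \<in> U \<longleftrightarrow> x \<in> carrier_vec n \<and> (\<Sum>k<n. cmod (x $ k) powr p) \<le> 1" for x
    unfolding U_def using lp_ball_iff[OF p0] by simp
  have "multiplier_bound U n (<) (truncation_constant p)"
    unfolding multiplier_bound_def
  proof (intro allI impI ballI)
    fix \<beta> C x y
    assume B: "\<forall>x\<in>U. \<forall>y\<in>U. cmod (\<Sum>a<n. \<Sum>b<n. \<beta> a b * (x $ a * y $ b)) \<le> C"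
      and x: "x \<in> U" and y: "y \<in> U"
    have C: "0 \<le> C" using B x y norm_ge_zero order_trans by blast
    define mass where "mass z A = (\<Sum>a\<in>A. cmod (z $ a) powr p)" for z :: "complex vec" and A
    \<comment> \<open>The restriction of \<open>z\<close> to \<open>A\<close>, normalized in \<open>\<ell>\<^sub>p\<close>.\<close>
    define part where "part z A = vec n (\<lambda>a. if a \<in> A then z $ a / of_real (mass z A powr (1 / p)) else 0)"
      for z :: "complex vec" and A
    have mass0: "mass z A \<ge> 0" for z A by (simp add: mass_def sum_nonneg)
    have part: "part z A \<in> U" if A: "A \<subseteq> {..<n}" and z: "mass z A \<noteq> 0" for z A
    proof -
      have pos: "mass z A > 0" using mass0[of z A] z by simp
      have "(\<Sum>k<n. cmod (part z A $ k) powr p) = (\<Sum>k\<in>A. cmod (part z A $ k) powr p)"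
        using A p0 by (intro sum.mono_neutral_right) (auto simp: part_def)
      also have "\<dots> = (\<Sum>k\<in>A. cmod (z $ k) powr p / mass z A)"
      proof (rule sum.cong[OF refl])
        fix k assume "k \<in> A"
        then have "cmod (part z A $ k) = cmod (z $ k) / mass z A powr (1 / p)"
          using A by (auto simp: part_def norm_divide)
        then show "cmod (part z A $ k) powr p = cmod (z $ k) powr p / mass z A"
          using p0 pos by (simp add: powr_divide powr_powr)
      qed
      also have "\<dots> = 1" using z by (simp add: mass_def flip: sum_divide_distrib)
      finally show ?thesis unfolding U by (simp add: part_def)
    qed
    have rect: "cmod (\<Sum>a\<in>A. \<Sum>b\<in>A'. \<beta> a b * (x $ a * y $ b))
        \<le> C * (mass x A powr (1 / p) * mass y A' powr (1 / p))"
      if A: "A \<subseteq> {..<n}" "A' \<subseteq> {..<n}" for A A'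
    proof (cases "mass x A = 0 \<or> mass y A' = 0")
      case True
      have fin: "finite A" "finite A'" using A finite_subset by blast+
      have "(\<Sum>a\<in>A. \<Sum>b\<in>A'. \<beta> a b * (x $ a * y $ b)) = 0"
        using True fin by (intro sum.neutral ballI) (auto simp: mass_def sum_nonneg_eq_0_iff)
      then show ?thesis using C by simp
    next
      case False
      let ?s = "mass x A powr (1 / p)" and ?t = "mass y A' powr (1 / p)"
      have st: "?s > 0" "?t > 0" using False mass0 by (auto simp: order_less_le)
      have "(\<Sum>a\<in>A. \<Sum>b\<in>A'. \<beta> a b * (x $ a * y $ b))
          = (\<Sum>a\<in>A. \<Sum>b\<in>A'. of_real (?s * ?t) * (\<beta> a b * (part x A $ a * part y A' $ b)))"
      proof (intro sum.cong refl)
        fix a b assume ab: "a \<in> A" "b \<in> A'"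
        then have "a < n" "b < n" using A by auto
        then show "\<beta> a b * (x $ a * y $ b) = of_real (?s * ?t) * (\<beta> a b * (part x A $ a * part y A' $ b))"
          using ab st False by (simp add: part_def)
      qed
      also have "\<dots> = (\<Sum>a<n. \<Sum>b<n. of_real (?s * ?t) * (\<beta> a b * (part x A $ a * part y A' $ b)))"
        using A by (intro sum.mono_neutral_cong_left) (auto simp: part_def intro!: sum.neutral sum.mono_neutral_left)
      also have "\<dots> = of_real (?s * ?t) * (\<Sum>a<n. \<Sum>b<n. \<beta> a b * (part x A $ a * part y A' $ b))"
        by (simp only: sum_distrib_left)
      also have "cmod \<dots> = ?s * ?t * cmod (\<Sum>a<n. \<Sum>b<n. \<beta> a b * (part x A $ a * part y A' $ b))"
        using st by (simp add: norm_mult)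
      also have "\<dots> \<le> ?s * ?t * C"
        using B part A False st by (intro mult_left_mono) auto
      finally show ?thesis by (simp add: mult_ac)
    qed
    have "cmod (\<Sum>a=0..<n. \<Sum>b=0..<n. of_bool (a < b) * (\<beta> a b * (x $ a * y $ b)))
        \<le> truncation_constant p * (C * (mass x {0..<n} powr (1 / p) * mass y {0..<n} powr (1 / p)))"
      unfolding mass_def
      by (rule triangular_sum_le[OF p _ _ C]) (use rect in \<open>auto simp: mass_def atLeast0LessThan\<close>)
    also have "\<dots> \<le> truncation_constant p * (C * (1 * 1))"
    proof -
      have "mass z {0..<n} powr (1 / p) \<le> 1" if "z \<in> U" for z
        using that U[of z] powr_inverse_le_one_iff[OF p0 mass0] by (simp add: mass_def atLeast0LessThan)
      then show ?thesis
        using x y C truncation_constant(1)[OF p] by (intro mult_left_mono mult_mono) auto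
    qed
    finally show "cmod (\<Sum>a<n. \<Sum>b<n. of_bool (a < b) * \<beta> a b * (x $ a * y $ b)) \<le> truncation_constant p * C"
      by (simp add: atLeast0LessThan mult.assoc)
  qed
  then show ?thesis unfolding U_def .
qed

section \<open>The non-symmetric polarization inequality\<close>

theorem theorem1p1:
  "(\<exists>c1::real. c1 \<ge> 1 \<and>
      (\<forall>(n::nat) (m::nat) (P :: complex vec \<Rightarrow> complex) (N :: complex vec \<Rightarrow> real).
         n \<ge> 2 \<longrightarrow> homogeneous_polynomial n m P \<longrightarrow>
         is_norm n N \<longrightarrow> one_unconditional n N \<longrightarrow>
         (SUP X \<in> {X :: nat \<Rightarrow> complex vec. \<forall>k<m. X k \<in> carrier_vec n \<and> N (X k) \<le> 1}.
            cmod (associated_form n m P X))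
         \<le> (c1 * ln (real n)) ^ (m\<^sup>2) *
           (SUP x \<in> {x. x \<in> carrier_vec n \<and> N x \<le> 1}. cmod (P x))))
   \<and>
   (\<forall>p::real. 1 \<le> p \<and> p < 2 \<longrightarrow>
      (\<exists>c2::real. c2 \<ge> 1 \<and>
        (\<forall>(n::nat) (m::nat) (P :: complex vec \<Rightarrow> complex).
           homogeneous_polynomial n m P \<longrightarrow>
           (SUP X \<in> {X :: nat \<Rightarrow> complex vec. \<forall>k<m. X k \<in> carrier_vec n \<and> lp_norm p (X k) \<le> 1}.
              cmod (associated_form n m P X))
           \<le> c2 ^ (m\<^sup>2) *
             (SUP x \<in> {x. x \<in> carrier_vec n \<and> lp_norm p x \<le> 1}. cmod (P x)))))"
proof (intro conjI allI impI)
  define c1 :: real where "c1 = 8 / ln 2"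
  have ln2: "0 < ln (2 :: real)" "ln 2 < (1 :: real)" using ln_2_less_1 by auto
  show "\<exists>c1::real. c1 \<ge> 1 \<and>
      (\<forall>(n::nat) (m::nat) (P :: complex vec \<Rightarrow> complex) (N :: complex vec \<Rightarrow> real).
         n \<ge> 2 \<longrightarrow> homogeneous_polynomial n m P \<longrightarrow>
         is_norm n N \<longrightarrow> one_unconditional n N \<longrightarrow>
         (SUP X \<in> {X :: nat \<Rightarrow> complex vec. \<forall>k<m. X k \<in> carrier_vec n \<and> N (X k) \<le> 1}.
            cmod (associated_form n m P X))
         \<le> (c1 * ln (real n)) ^ (m\<^sup>2) *
           (SUP x \<in> {x. x \<in> carrier_vec n \<and> N x \<le> 1}. cmod (P x)))"
  proof (intro exI conjI allI impI)
    show "c1 \<ge> 1" using ln2 by (simp add: c1_def field_simps)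
  next
    fix n m :: nat and P :: "complex vec \<Rightarrow> complex" and N :: "complex vec \<Rightarrow> real"
    assume n: "n \<ge> 2" and P: "homogeneous_polynomial n m P"
      and N: "is_norm n N" "one_unconditional n N"
    interpret unit_ball n "{x. x \<in> carrier_vec n \<and> N x \<le> 1}"
      using N by (rule unit_ball_norm)
    \<comment> \<open>The number of binary digits; for \<open>n \<ge> 2\<close> the rounding costs at most another factor 2.\<close>
    define L where "L = nat \<lceil>log 2 (real n)\<rceil>"
    have log1: "1 \<le> log 2 (real n)" using n by simp
    have L: "log 2 (real n) \<le> real L" "real L \<le> log 2 (real n) + 1" "1 \<le> real L"
      using log1 unfolding L_def by linarith+
    have "real n = 2 powr log 2 (real n)" using n by simp
    also have "\<dots> \<le> 2 powr real L" using L(1) by simp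
    finally have "real n \<le> real (2 ^ L)" by (simp add: powr_realpow)
    then have pow: "n \<le> 2 ^ L" by (simp only: of_nat_le_iff)
    have "4 * real L \<le> 8 * log 2 (real n)" using L(2) log1 by linarith
    also have "\<dots> = c1 * ln (real n)" by (simp add: c1_def log_def)
    finally show "(SUP X \<in> {X :: nat \<Rightarrow> complex vec. \<forall>k<m. X k \<in> carrier_vec n \<and> N (X k) \<le> 1}.
            cmod (associated_form n m P X))
         \<le> (c1 * ln (real n)) ^ (m\<^sup>2) *
           (SUP x \<in> {x. x \<in> carrier_vec n \<and> N x \<le> 1}. cmod (P x))"
      using sup_associated_form_le[OF multiplier_bound_less[OF pow] L(3) _ P] by simp
  qed
next
  fix p :: real
  assume "1 \<le> p \<and> p < 2"
  then have p: "1 \<le> p" "p < 2" by auto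
  have K: "1 \<le> truncation_constant p" using truncation_constant(1)[OF p] by simp
  show "\<exists>c2::real. c2 \<ge> 1 \<and>
        (\<forall>(n::nat) (m::nat) (P :: complex vec \<Rightarrow> complex).
           homogeneous_polynomial n m P \<longrightarrow>
           (SUP X \<in> {X :: nat \<Rightarrow> complex vec. \<forall>k<m. X k \<in> carrier_vec n \<and> lp_norm p (X k) \<le> 1}.
              cmod (associated_form n m P X))
           \<le> c2 ^ (m\<^sup>2) *
             (SUP x \<in> {x. x \<in> carrier_vec n \<and> lp_norm p x \<le> 1}. cmod (P x)))"
  proof (intro exI conjI allI impI)
    show "4 * truncation_constant p \<ge> 1" using K by simp
  next
    fix n m :: nat and P :: "complex vec \<Rightarrow> complex"
    assume P: "homogeneous_polynomial n m P"
    show "(SUP X \<in> {X :: nat \<Rightarrow> complex vec. \<forall>k<m. X k \<in> carrier_vec n \<and> lp_norm p (X k) \<le> 1}.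
              cmod (associated_form n m P X))
           \<le> (4 * truncation_constant p) ^ (m\<^sup>2) *
             (SUP x \<in> {x. x \<in> carrier_vec n \<and> lp_norm p x \<le> 1}. cmod (P x))"
      using unit_ball.sup_associated_form_le[OF unit_ball_lp[OF p(1)] multiplier_bound_less_lp[OF p] K order_refl P]
      by simp
  qed
qed

end
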